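(* Let $\alpha\in(0,1)$ and let $\tau_\alpha$ be any stopping time satisfying $$\sup_{P\in\mathcal P}P(\tau_\alpha<\infty)\le\alpha.$$ Then for any alternative distribution $Q$ (with $\ell_Q^\star>0$), $$\frac{\mathbb E_Q[\tau_\alpha]}{\log(1/\alpha)}\ge\frac1{\ell_Q^\star},\qquad\text{where}\quad \ell_Q^\star=\max_{\lambda\in\triangle_d}\mathbb E_Q\left[\log(\lambda^\top\mathbf E_1)\right].$$
   Context: Fix $d\in\mathbb N$ and let $\triangle_d=\{\lambda\in[0,1]^{d+1}:\sum_{j=0}^d\lambda^{(j)}=1\}$. Let $(\mathbf E_n)_{n=1}^\infty$, $\mathbf E_n=(E_n^{(0)},\dots,E_n^{(d)})$, be random vectors with values in $[0,\infty)^{d+1}$ such that $E_n^{(0)}=1$ deterministically; the coordinates of $\mathbf E_n$ may be arbitrarily dependent. Let $\mathcal F_n=\sigma(\mathbf E_1,\dots,\mathbf E_n)$, with $\mathcal F_0$ trivial; stopping times are $\mathbb N\cup\{\infty\}$-valued with $\{\tau=n\}\in\mathcal F_n$. Under every distribution considered, $(\mathbf E_n)$ is i.i.d. $\mathcal P$ is the set of all distributions $P$ (making $(\mathbf E_n)$ i.i.d.) with $\mathbb E_P[E_1^{(j)}]\le 1$ for each $j\in\{1,\dots,d\}$. An alternative distribution is a distribution $Q$ under which $(\mathbf E_n)$ is i.i.d. The expectations defining $\ell_Q^\star$ are understood to be well defined; $\log0=-\infty$, $1/\infty=0$. *)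

theory Defs
  imports "HOL-Probability.Probability"
begin

text \<open>
  A vector with coordinates \<open>0, ..., d\<close> is an extensional function on \<open>{0..d}\<close>.  Since
  distributions range over all laws of the sequence \<open>evec 1, evec 2, ...\<close>, the sample space is the
  canonical space of paths and \<open>evec n\<close> is its \<open>n\<close>-th coordinate, \<open>n \<ge> 1\<close>.  The constraints
  \<open>evec n \<omega> 0 = 1\<close> and \<open>evec n \<omega> j \<ge> 0\<close> thereby hold on every path, not only almost surely.
\<close>

definition prob_simplex :: "nat \<Rightarrow> (nat \<Rightarrow> real) set" where
  "prob_simplex d = {l \<in> PiE {0..d} (\<lambda>_. {0..1}). (\<Sum>j=0..d. l j) = 1}"

definition vec_space :: "nat \<Rightarrow> (nat \<Rightarrow> real) measure" where
  "vec_space d =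
     restrict_space (\<Pi>\<^sub>M j\<in>{0..d}. borel) {x. x 0 = 1 \<and> (\<forall>j\<in>{0..d}. 0 \<le> x j)}"

type_synonym path = "nat \<Rightarrow> nat \<Rightarrow> real"

definition path_space :: "nat \<Rightarrow> path measure" where
  "path_space d = (\<Pi>\<^sub>M n\<in>{1..}. vec_space d)"

definition evec :: "nat \<Rightarrow> path \<Rightarrow> nat \<Rightarrow> real" where
  "evec n \<omega> = \<omega> n"

definition filt :: "nat \<Rightarrow> nat \<Rightarrow> path measure" where
  "filt d n = sigma (space (path_space d))
     (\<Union>i\<in>{1..n}. {evec i -` A \<inter> space (path_space d) | A. A \<in> sets (vec_space d)})"

text \<open>
  The stopping times of the library take values in the time set itself; here the value
  \<open>\<infinity>\<close> must be allowed while time is \<open>nat\<close>.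
\<close>

definition is_stopping_time :: "nat \<Rightarrow> (path \<Rightarrow> enat) \<Rightarrow> bool" where
  "is_stopping_time d \<tau> \<longleftrightarrow>
     (\<forall>n::nat. {\<omega> \<in> space (path_space d). \<tau> \<omega> = enat n} \<in> sets (filt d n))"

definition iid_distributions :: "nat \<Rightarrow> path measure set" where
  "iid_distributions d = {P. prob_space P \<and> sets P = sets (path_space d) \<and>
     prob_space.indep_vars P (\<lambda>_. vec_space d) evec {1..} \<and>
     (\<forall>n\<ge>1. distr P (vec_space d) (evec n) = distr P (vec_space d) (evec 1))}"

definition null_distributions :: "nat \<Rightarrow> path measure set" where
  "null_distributions d = {P \<in> iid_distributions d.
     \<forall>j\<in>{1..d}. (\<integral>\<^sup>+ \<omega>. ennreal (evec 1 \<omega> j) \<partial>P) \<le> 1}"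

text \<open>Extended logarithm on \<open>[0, \<infinity>)\<close>, with \<open>log 0 = -\<infinity>\<close>.\<close>

definition elog :: "real \<Rightarrow> ereal" where
  "elog x = (if x = 0 then -\<infinity> else ereal (ln x))"

text \<open>
  Expectation of an extended real random variable as the difference of the integrals of its
  positive and negative parts; \<open>e2ennreal\<close> maps negative values to \<open>0\<close>.  It is meaningful
  only if the two integrals are not both infinite.
\<close>

definition expectation_defined :: "'a measure \<Rightarrow> ('a \<Rightarrow> ereal) \<Rightarrow> bool" where
  "expectation_defined M f \<longleftrightarrow>
     (\<integral>\<^sup>+ x. e2ennreal (f x) \<partial>M) < \<infinity> \<or> (\<integral>\<^sup>+ x. e2ennreal (- f x) \<partial>M) < \<infinity>"

definition ext_expectation :: "'a measure \<Rightarrow> ('a \<Rightarrow> ereal) \<Rightarrow> ereal" where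
  "ext_expectation M f =
     enn2ereal (\<integral>\<^sup>+ x. e2ennreal (f x) \<partial>M) - enn2ereal (\<integral>\<^sup>+ x. e2ennreal (- f x) \<partial>M)"

definition log_mix :: "nat \<Rightarrow> (nat \<Rightarrow> real) \<Rightarrow> path \<Rightarrow> ereal" where
  "log_mix d l \<omega> = elog (\<Sum>j=0..d. l j * evec 1 \<omega> j)"

text \<open>Written as a supremum; that it is attained has to be proved where it is used as a maximum.\<close>

definition ell_star :: "nat \<Rightarrow> path measure \<Rightarrow> ereal" where
  "ell_star d Q = (SUP l\<in>prob_simplex d. ext_expectation Q (log_mix d l))"

end

theory Submission imports Defs
begin

text \<open>
  The bound compares the alternative \<open>Q\<close>, under which the observations have law \<open>\<mu>\<close>, with one specially
  chosen null distribution \<open>P\<close>.  Write \<open>\<lambda>\<^sup>T x\<close> for \<open>mix d \<lambda> x\<close>, and let \<open>\<lambda>\<close> maximise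
  \<open>E log (\<lambda>\<^sup>T x)\<close> under \<open>\<mu>\<close>.  A maximiser exists by compactness of the simplex and upper
  semicontinuity if \<open>log (\<Sum>j. x j)\<close> is integrable; otherwise the maximum is \<open>\<infinity>\<close>
  (\<open>log_optimal_mixture_exists\<close>).  If the maximum or the expectation of \<open>\<tau>\<close> is infinite, the bound is
  immediate; from now on both are finite.

  Differentiating the objective at \<open>\<lambda>\<close> towards the vertex \<open>j\<close> shows that \<open>x j / (\<lambda>\<^sup>T x)\<close> has expectation at most \<open>1\<close>
  for every \<open>j\<close> (\<open>log_optimal_numeraire\<close>).  For \<open>j = 0\<close> this says that \<open>1 / (\<lambda>\<^sup>T x)\<close> is a subprobability
  density with respect to \<open>\<mu>\<close>, and for \<open>j \<ge> 1\<close> that coordinate \<open>j\<close> has expectation at most \<open>1\<close> under it.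
  Putting the missing mass at \<open>(1, 0, \<dots>, 0)\<close> (\<open>complete_subprobability\<close>) gives a law \<open>\<nu>\<close> whose i.i.d.
  sequence has a null distribution \<open>P\<close>, and the Kullback-Leibler divergence of \<open>Q\<close> from \<open>P\<close> is at most
  \<open>E log (\<lambda>\<^sup>T x)\<close> per observation.

  Let \<open>S\<close> be the sum of \<open>log (\<lambda>\<^sup>T x)\<close> over the observations up to \<open>\<tau>\<close>.  On every event decided by time \<open>n\<close>,
  the likelihood ratio of \<open>P\<close> to \<open>Q\<close> is at least the product of the factors \<open>1 / (\<lambda>\<^sup>T x)\<close>.  Hence the error bound
  at \<open>P\<close> gives \<open>E exp (- S) \<le> \<alpha>\<close> under \<open>Q\<close>.  Jensen's inequality and Wald's identity then give
  \<open>log (1 / \<alpha>) \<le> E S = \<kappa> E \<tau>\<close> with \<open>\<kappa>\<close> the maximal expected logarithm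
  (\<open>expected_stopping_time_change_of_measure\<close>).
\<close>

section \<open>Change of measure on infinite products\<close>

text \<open>
  If \<open>f\<close> times one law is below another law, the products of the two laws compare with
  likelihood factor \<open>\<Prod> f\<close>.  Only an inequality is available because \<open>f\<close> will be a density of total
  mass possibly less than \<open>1\<close>.  The induction over the index set peels off one coordinate,
  using the one-dimensional comparison inside and the induction hypothesis outside.
\<close>

lemma nn_integral_product_dominated:
  fixes f :: "'a \<Rightarrow> ennreal" and h :: "('i \<Rightarrow> 'a) \<Rightarrow> ennreal"
  assumes \<mu>: "prob_space \<mu>" and \<nu>: "prob_space \<nu>" and sets_eq: "sets \<nu> = sets \<mu>"
    and f: "f \<in> borel_measurable \<mu>"
    and dominated: "\<And>k. k \<in> borel_measurable \<mu> \<Longrightarrow> (\<integral>\<^sup>+x. f x * k x \<partial>\<mu>) \<le> (\<integral>\<^sup>+x. k x \<partial>\<nu>)"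
    and "finite I" and "h \<in> borel_measurable (PiM I (\<lambda>_. \<mu>))"
  shows "(\<integral>\<^sup>+x. (\<Prod>i\<in>I. f (x i)) * h x \<partial>PiM I (\<lambda>_. \<mu>)) \<le> (\<integral>\<^sup>+x. h x \<partial>PiM I (\<lambda>_. \<nu>))"
  using \<open>finite I\<close> \<open>h \<in> borel_measurable (PiM I (\<lambda>_. \<mu>))\<close>
proof (induction I arbitrary: h rule: finite_induct)
  case empty
  show ?case by (simp add: PiM_empty)
next
  case (insert i I)
  interpret \<mu>: prob_space \<mu> by fact
  interpret \<nu>: prob_space \<nu> by fact
  interpret M: product_sigma_finite "\<lambda>_. \<mu>" by standard
  interpret N: product_sigma_finite "\<lambda>_. \<nu>" by standard
  have sets_Pi: "sets (PiM J (\<lambda>_. \<nu>)) = sets (PiM J (\<lambda>_. \<mu>))" for J :: "'i set"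
    by (intro sets_PiM_cong refl sets_eq)
  note [measurable] = f insert.prems
  have h': "h \<in> borel_measurable (PiM (insert i I) (\<lambda>_. \<nu>))"
    using insert.prems by (simp cong: measurable_cong_sets add: measurable_cong_sets[OF sets_Pi refl])
  have split: "(\<lambda>(x, y). h (x(i := y))) \<in> borel_measurable (PiM I (\<lambda>_. \<mu>) \<Otimes>\<^sub>M \<mu>)"
    using measurable_compose[OF measurable_add_dim insert.prems] by (simp add: split_def)
  have inner [measurable]: "(\<lambda>x. \<integral>\<^sup>+y. f y * h (x(i := y)) \<partial>\<mu>) \<in> borel_measurable (PiM I (\<lambda>_. \<mu>))"
    using split by (intro \<mu>.borel_measurable_nn_integral) (simp add: split_def)
  have "(\<integral>\<^sup>+x. (\<Prod>j\<in>insert i I. f (x j)) * h x \<partial>PiM (insert i I) (\<lambda>_. \<mu>))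
      = (\<integral>\<^sup>+x. \<integral>\<^sup>+y. (\<Prod>j\<in>insert i I. f ((x(i := y)) j)) * h (x(i := y)) \<partial>\<mu> \<partial>PiM I (\<lambda>_. \<mu>))"
    by (rule M.product_nn_integral_insert) (use insert in measurable)
  also have "\<dots> = (\<integral>\<^sup>+x. (\<Prod>j\<in>I. f (x j)) * (\<integral>\<^sup>+y. f y * h (x(i := y)) \<partial>\<mu>) \<partial>PiM I (\<lambda>_. \<mu>))"
  proof (rule nn_integral_cong)
    fix x assume x: "x \<in> space (PiM I (\<lambda>_. \<mu>))"
    have "(\<lambda>y. h (x(i := y))) \<in> borel_measurable \<mu>"
      using measurable_Pair2[OF split x] by simp
    moreover have "(\<Prod>j\<in>I. f (if j = i then y else x j)) = (\<Prod>j\<in>I. f (x j))" for y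
      using insert by (intro prod.cong) auto
    ultimately show "(\<integral>\<^sup>+y. (\<Prod>j\<in>insert i I. f ((x(i := y)) j)) * h (x(i := y)) \<partial>\<mu>)
        = (\<Prod>j\<in>I. f (x j)) * (\<integral>\<^sup>+y. f y * h (x(i := y)) \<partial>\<mu>)"
      using insert by (subst nn_integral_cmult[symmetric]) (auto simp: ac_simps)
  qed
  also have "\<dots> \<le> (\<integral>\<^sup>+x. (\<integral>\<^sup>+y. f y * h (x(i := y)) \<partial>\<mu>) \<partial>PiM I (\<lambda>_. \<nu>))"
    by (rule insert.IH) measurable
  also have "\<dots> \<le> (\<integral>\<^sup>+x. (\<integral>\<^sup>+y. h (x(i := y)) \<partial>\<nu>) \<partial>PiM I (\<lambda>_. \<nu>))"
  proof (rule nn_integral_mono)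
    fix x assume "x \<in> space (PiM I (\<lambda>_. \<nu>))"
    then have x: "x \<in> space (PiM I (\<lambda>_. \<mu>))"
      using sets_eq_imp_space_eq[OF sets_Pi] by simp
    show "(\<integral>\<^sup>+y. f y * h (x(i := y)) \<partial>\<mu>) \<le> (\<integral>\<^sup>+y. h (x(i := y)) \<partial>\<nu>)"
      using measurable_Pair2[OF split x] by (intro dominated) simp
  qed
  also have "\<dots> = (\<integral>\<^sup>+x. h x \<partial>PiM (insert i I) (\<lambda>_. \<nu>))"
    using insert h' by (intro N.product_nn_integral_insert[symmetric])
  finally show ?case .
qed

text \<open>
  The events decided by the first \<open>n\<close> coordinates of a sequence with values in \<open>M\<close>.  As preimages of
  events of a finite product, they reduce statements about the infinite product to finite ones,
  where Fubini applies.
\<close>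

definition past :: "'a measure \<Rightarrow> nat \<Rightarrow> (nat \<Rightarrow> 'a) set set" where
  "past M n = {{\<omega> \<in> space (PiM {1..} (\<lambda>_. M)). restrict \<omega> {1..n} \<in> B} |
     B. B \<in> sets (PiM {1..n} (\<lambda>_. M))}"

lemma past_cong:
  assumes "sets M = sets N" shows "past M n = past N n"
proof -
  have "sets (PiM J (\<lambda>_. M)) = sets (PiM J (\<lambda>_. N))" for J :: "nat set"
    by (intro sets_PiM_cong refl assms)
  moreover from this have "space (PiM J (\<lambda>_. M)) = space (PiM J (\<lambda>_. N))" for J :: "nat set"
    by (rule sets_eq_imp_space_eq)
  ultimately show ?thesis by (simp add: past_def)
qed

text \<open>
  The preimages already form a \<sigma>-algebra, which supplies the closure properties below.
\<close>

lemma sets_past: "sets (vimage_algebra (space (PiM {1..} (\<lambda>_. M))) (\<lambda>\<omega>. restrict \<omega> {1..n})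
    (PiM {1..n} (\<lambda>_. M))) = past M n"
  by (subst sets_vimage_algebra2) (auto simp: past_def space_PiM)

lemma past_subset: "past M n \<subseteq> sets (PiM {1..} (\<lambda>_. M))"
proof
  fix A assume "A \<in> past M n"
  then obtain B where [measurable]: "B \<in> sets (PiM {1..n} (\<lambda>_. M))"
    and A: "A = {\<omega> \<in> space (PiM {1..} (\<lambda>_. M)). restrict \<omega> {1..n} \<in> B}"
    by (auto simp: past_def)
  have [measurable]: "(\<lambda>\<omega>. restrict \<omega> {1..n}) \<in> measurable (PiM {1..} (\<lambda>_. M)) (PiM {1..n} (\<lambda>_. M))"
    by (rule measurable_restrict_subset) auto
  show "A \<in> sets (PiM {1..} (\<lambda>_. M))" unfolding A by measurable
qed

lemma past_Diff: "A \<in> past M n \<Longrightarrow> space (PiM {1..} (\<lambda>_. M)) - A \<in> past M n"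
  using sets.compl_sets[of A "vimage_algebra (space (PiM {1..} (\<lambda>_. M))) (\<lambda>\<omega>. restrict \<omega> {1..n})
    (PiM {1..n} (\<lambda>_. M))"] unfolding sets_past by simp

lemma past_UN: "finite I \<Longrightarrow> (\<And>i. i \<in> I \<Longrightarrow> A i \<in> past M n) \<Longrightarrow> (\<Union>i\<in>I. A i) \<in> past M n"
  using sets.finite_UN[of I A "vimage_algebra (space (PiM {1..} (\<lambda>_. M))) (\<lambda>\<omega>. restrict \<omega> {1..n})
    (PiM {1..n} (\<lambda>_. M))"] unfolding sets_past by simp

lemma past_mono: assumes "m \<le> n" shows "past M m \<subseteq> past M n"
proof
  fix A assume "A \<in> past M m"
  then obtain B where [measurable]: "B \<in> sets (PiM {1..m} (\<lambda>_. M))"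
    and A: "A = {\<omega> \<in> space (PiM {1..} (\<lambda>_. M)). restrict \<omega> {1..m} \<in> B}"
    by (auto simp: past_def)
  have [measurable]: "(\<lambda>\<omega>. restrict \<omega> {1..m}) \<in> measurable (PiM {1..n} (\<lambda>_. M)) (PiM {1..m} (\<lambda>_. M))"
    using assms by (intro measurable_restrict_subset) auto
  have "{\<omega> \<in> space (PiM {1..n} (\<lambda>_. M)). restrict \<omega> {1..m} \<in> B} \<in> sets (PiM {1..n} (\<lambda>_. M))"
    by measurable
  moreover have "A = {\<omega> \<in> space (PiM {1..} (\<lambda>_. M)). restrict \<omega> {1..n} \<in>
      {\<omega> \<in> space (PiM {1..n} (\<lambda>_. M)). restrict \<omega> {1..m} \<in> B}}"
    using assms by (auto simp: A space_PiM Int_absorb1)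
  ultimately show "A \<in> past M n" unfolding past_def by blast
qed

lemma nn_integral_past:
  fixes n :: nat
  assumes M: "prob_space M" and g: "g \<in> borel_measurable (PiM {1..n} (\<lambda>_. M))"
  shows "(\<integral>\<^sup>+\<omega>. g (restrict \<omega> {1..n}) \<partial>PiM {1..} (\<lambda>_. M)) = (\<integral>\<^sup>+x. g x \<partial>PiM {1..n} (\<lambda>_. M))"
proof -
  interpret prob_space M by fact
  interpret product_prob_space "\<lambda>_. M" "{1::nat..}" by standard
  have "(\<lambda>\<omega>. restrict \<omega> {1..n}) \<in> measurable (PiM {1..} (\<lambda>_. M)) (PiM {1..n} (\<lambda>_. M))"
    by (rule measurable_restrict_subset) auto
  with g have "(\<integral>\<^sup>+\<omega>. g (restrict \<omega> {1..n}) \<partial>PiM {1..} (\<lambda>_. M))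
      = (\<integral>\<^sup>+x. g x \<partial>distr (PiM {1..} (\<lambda>_. M)) (PiM {1..n} (\<lambda>_. M)) (\<lambda>\<omega>. restrict \<omega> {1..n}))"
    by (simp add: nn_integral_distr)
  moreover have "distr (PiM {1..} (\<lambda>_. M)) (PiM {1..n} (\<lambda>_. M)) (\<lambda>\<omega>. restrict \<omega> {1..n})
      = PiM {1..n} (\<lambda>_. M)"
    by (rule distr_PiM_restrict_finite) auto
  ultimately show ?thesis by simp
qed

text \<open>
  Change of measure up to time \<open>n\<close>: on events of the first \<open>n\<close> coordinates, the infinite product
  of \<open>\<nu>\<close> is at least \<open>f(\<omega> 1) \<cdots> f(\<omega> n)\<close> times that of \<open>\<mu>\<close>.  On the whole infinite product
  the two laws may be mutually singular.
\<close>

lemma nn_integral_past_dominated: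
  assumes \<mu>: "prob_space \<mu>" and \<nu>: "prob_space \<nu>" and sets_eq: "sets \<nu> = sets \<mu>"
    and f [measurable]: "f \<in> borel_measurable \<mu>"
    and dominated: "\<And>k. k \<in> borel_measurable \<mu> \<Longrightarrow> (\<integral>\<^sup>+x. f x * k x \<partial>\<mu>) \<le> (\<integral>\<^sup>+x. k x \<partial>\<nu>)"
    and A: "A \<in> past \<mu> n"
  shows "(\<integral>\<^sup>+\<omega>. (\<Prod>i\<in>{1..n}. f (\<omega> i)) * indicator A \<omega> \<partial>PiM {1..} (\<lambda>_. \<mu>))
    \<le> emeasure (PiM {1..} (\<lambda>_. \<nu>)) A"
proof -
  obtain B where B [measurable]: "B \<in> sets (PiM {1..n} (\<lambda>_. \<mu>))"
    and A: "A = {\<omega> \<in> space (PiM {1..} (\<lambda>_. \<mu>)). restrict \<omega> {1..n} \<in> B}"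
    using A by (auto simp: past_def)
  have sets_Pi: "sets (PiM J (\<lambda>_. \<nu>)) = sets (PiM J (\<lambda>_. \<mu>))" for J :: "nat set"
    by (intro sets_PiM_cong refl sets_eq)
  have B': "B \<in> sets (PiM {1..n} (\<lambda>_. \<nu>))" using B sets_Pi by simp
  have A': "A \<in> sets (PiM {1..} (\<lambda>_. \<nu>))"
    using \<open>A \<in> past \<mu> n\<close> past_subset[of \<mu> n] sets_Pi by auto
  have "(\<integral>\<^sup>+\<omega>. (\<Prod>i\<in>{1..n}. f (\<omega> i)) * indicator A \<omega> \<partial>PiM {1..} (\<lambda>_. \<mu>))
      = (\<integral>\<^sup>+\<omega>. (\<lambda>x. (\<Prod>i\<in>{1..n}. f (x i)) * indicator B x) (restrict \<omega> {1..n}) \<partial>PiM {1..} (\<lambda>_. \<mu>))"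
    by (intro nn_integral_cong) (auto simp: A indicator_def)
  also have "\<dots> = (\<integral>\<^sup>+x. (\<Prod>i\<in>{1..n}. f (x i)) * indicator B x \<partial>PiM {1..n} (\<lambda>_. \<mu>))"
    by (rule nn_integral_past[OF \<mu>]) measurable
  also have "\<dots> \<le> (\<integral>\<^sup>+x. indicator B x \<partial>PiM {1..n} (\<lambda>_. \<nu>))"
    by (rule nn_integral_product_dominated[OF \<mu> \<nu> sets_eq f dominated _ borel_measurable_indicator[OF B]]) simp_all
  also have "\<dots> = (\<integral>\<^sup>+\<omega>. indicator B (restrict \<omega> {1..n}) \<partial>PiM {1..} (\<lambda>_. \<nu>))"
    using B' by (intro nn_integral_past[OF \<nu>, symmetric]) auto
  also have "\<dots> = (\<integral>\<^sup>+\<omega>. indicator A \<omega> \<partial>PiM {1..} (\<lambda>_. \<nu>))"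
    using sets_eq_imp_space_eq[OF sets_Pi]
    by (intro nn_integral_cong) (auto simp: A indicator_def)
  finally show ?thesis using A' by simp
qed

text \<open>
  The next coordinate is independent of the past; the index shift to \<open>Suc n\<close> is what makes
  \<open>{n < \<tau>}\<close> an event of the past in Wald's identity.
\<close>

lemma nn_integral_next_past:
  assumes M: "prob_space M" and g [measurable]: "g \<in> borel_measurable M" and A: "A \<in> past M n"
  shows "(\<integral>\<^sup>+\<omega>. g (\<omega> (Suc n)) * indicator A \<omega> \<partial>PiM {1..} (\<lambda>_. M))
    = (\<integral>\<^sup>+x. g x \<partial>M) * emeasure (PiM {1..} (\<lambda>_. M)) A"
proof -
  interpret prob_space M by fact
  interpret product_sigma_finite "\<lambda>_. M" by standard
  obtain B where B [measurable]: "B \<in> sets (PiM {1..n} (\<lambda>_. M))"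
    and A: "A = {\<omega> \<in> space (PiM {1..} (\<lambda>_. M)). restrict \<omega> {1..n} \<in> B}"
    using A by (auto simp: past_def)
  have A': "A \<in> sets (PiM {1..} (\<lambda>_. M))" using \<open>A \<in> past M n\<close> past_subset by auto
  have [measurable]: "(\<lambda>x. restrict x {1..n}) \<in> measurable (PiM {1..Suc n} (\<lambda>_. M)) (PiM {1..n} (\<lambda>_. M))"
    by (rule measurable_restrict_subset) auto
  let ?G = "\<lambda>x. g (x (Suc n)) * indicator B (restrict x {1..n})"
  have G: "?G \<in> borel_measurable (PiM {1..Suc n} (\<lambda>_. M))" by measurable
  have ins: "{1..Suc n} = insert (Suc n) {1..n}" by auto
  have "(\<integral>\<^sup>+\<omega>. g (\<omega> (Suc n)) * indicator A \<omega> \<partial>PiM {1..} (\<lambda>_. M))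
      = (\<integral>\<^sup>+\<omega>. ?G (restrict \<omega> {1..Suc n}) \<partial>PiM {1..} (\<lambda>_. M))"
    by (intro nn_integral_cong) (auto simp: A indicator_def Int_absorb1)
  also have "\<dots> = (\<integral>\<^sup>+x. ?G x \<partial>PiM {1..Suc n} (\<lambda>_. M))"
    by (rule nn_integral_past[OF M G])
  also have "\<dots> = (\<integral>\<^sup>+x. \<integral>\<^sup>+y. ?G (x(Suc n := y)) \<partial>M \<partial>PiM {1..n} (\<lambda>_. M))"
    unfolding ins by (rule product_nn_integral_insert) (use G[unfolded ins] in simp_all)
  also have "\<dots> = (\<integral>\<^sup>+x. (\<integral>\<^sup>+y. g y \<partial>M) * indicator B x \<partial>PiM {1..n} (\<lambda>_. M))"
  proof (intro nn_integral_cong)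
    fix x assume "x \<in> space (PiM {1..n} (\<lambda>_. M))"
    then have "restrict (x(Suc n := y)) {1..n} = x" for y
      by (auto simp: space_PiM PiE_def extensional_def)
    then show "(\<integral>\<^sup>+y. ?G (x(Suc n := y)) \<partial>M) = (\<integral>\<^sup>+y. g y \<partial>M) * indicator B x"
      by (simp add: nn_integral_multc)
  qed
  also have "\<dots> = (\<integral>\<^sup>+y. g y \<partial>M) * (\<integral>\<^sup>+x. indicator B x \<partial>PiM {1..n} (\<lambda>_. M))"
    by (rule nn_integral_cmult) measurable
  also have "(\<integral>\<^sup>+x. indicator B x \<partial>PiM {1..n} (\<lambda>_. M))
      = (\<integral>\<^sup>+\<omega>. indicator B (restrict \<omega> {1..n}) \<partial>PiM {1..} (\<lambda>_. M))"
    by (rule nn_integral_past[OF M, symmetric]) measurable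
  also have "\<dots> = (\<integral>\<^sup>+\<omega>. indicator A \<omega> \<partial>PiM {1..} (\<lambda>_. M))"
    by (intro nn_integral_cong) (auto simp: A indicator_def)
  finally show ?thesis using A' by simp
qed

section \<open>Wald's identity and the cost of stopping\<close>

(* Keeps the index sets {1..} and {1..n} from being rewritten to {Suc 0..} and {Suc 0..n}. *)
declare One_nat_def [simp del]

definition adapted_stopping :: "'a measure \<Rightarrow> ((nat \<Rightarrow> 'a) \<Rightarrow> enat) \<Rightarrow> bool" where
  "adapted_stopping M \<tau> \<longleftrightarrow> (\<forall>n::nat. {\<omega> \<in> space (PiM {1..} (\<lambda>_. M)). \<tau> \<omega> = enat n} \<in> past M n)"

lemma adapted_stopping_greater:
  assumes "adapted_stopping M \<tau>"
  shows "{\<omega> \<in> space (PiM {1..} (\<lambda>_. M)). enat n < \<tau> \<omega>} \<in> past M n"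
proof -
  have "(\<Union>k\<in>{..n}. {\<omega> \<in> space (PiM {1..} (\<lambda>_. M)). \<tau> \<omega> = enat k}) \<in> past M n"
    using assms past_mono[of _ n M] by (intro past_UN) (auto simp: adapted_stopping_def)
  then have *: "space (PiM {1..} (\<lambda>_. M))
      - (\<Union>k\<in>{..n}. {\<omega> \<in> space (PiM {1..} (\<lambda>_. M)). \<tau> \<omega> = enat k}) \<in> past M n"
    by (rule past_Diff)
  have "enat n < \<tau> \<omega> \<longleftrightarrow> (\<forall>k\<le>n. \<tau> \<omega> \<noteq> enat k)" for \<omega>
    by (cases "\<tau> \<omega>") (auto simp flip: not_le)
  then have "{\<omega> \<in> space (PiM {1..} (\<lambda>_. M)). enat n < \<tau> \<omega>} = space (PiM {1..} (\<lambda>_. M))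
      - (\<Union>k\<in>{..n}. {\<omega> \<in> space (PiM {1..} (\<lambda>_. M)). \<tau> \<omega> = enat k})"
    by auto
  with * show ?thesis by (simp only:)
qed

lemma measurable_adapted_stopping:
  assumes "adapted_stopping M \<tau>"
  shows "\<tau> \<in> measurable (PiM {1..} (\<lambda>_. M)) (count_space UNIV)"
proof -
  have fin: "\<tau> -` {enat n} \<inter> space (PiM {1..} (\<lambda>_. M)) \<in> sets (PiM {1..} (\<lambda>_. M))" for n
    using assms past_subset[of M n] unfolding adapted_stopping_def vimage_def
    by (auto simp: Collect_conj_eq Int_commute)
  have "\<tau> -` {\<infinity>} \<inter> space (PiM {1..} (\<lambda>_. M))
      = space (PiM {1..} (\<lambda>_. M)) - (\<Union>n. \<tau> -` {enat n} \<inter> space (PiM {1..} (\<lambda>_. M)))"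
    by auto
  also have "\<dots> \<in> sets (PiM {1..} (\<lambda>_. M))"
    using fin by (intro sets.Diff sets.countable_UN) auto
  finally have "\<tau> -` {e} \<inter> space (PiM {1..} (\<lambda>_. M)) \<in> sets (PiM {1..} (\<lambda>_. M))" for e
    using fin by (cases e) auto
  then show ?thesis by (simp add: measurable_count_space_eq2_countable)
qed

text \<open>
  Wald's identity for nonnegative summands: the summand at
  time \<open>Suc t\<close> is collected exactly when \<open>t < \<tau>\<close>, an event independent of it, and the
  probabilities of these events add up to the expectation of \<open>\<tau>\<close>.
\<close>

lemma wald_nn_integral:
  assumes M: "prob_space M" and \<tau>: "adapted_stopping M \<tau>" and g [measurable]: "g \<in> borel_measurable M"
  shows "(\<integral>\<^sup>+\<omega>. (\<Sum>t. g (\<omega> (Suc t)) *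
      indicator {\<omega> \<in> space (PiM {1..} (\<lambda>_. M)). enat t < \<tau> \<omega>} \<omega>) \<partial>PiM {1..} (\<lambda>_. M))
    = (\<integral>\<^sup>+x. g x \<partial>M) * (\<integral>\<^sup>+\<omega>. ennreal_of_enat (\<tau> \<omega>) \<partial>PiM {1..} (\<lambda>_. M))"
proof -
  let ?P = "PiM {1::nat..} (\<lambda>_. M)"
  let ?A = "\<lambda>t. {\<omega> \<in> space ?P. enat t < \<tau> \<omega>}"
  have [measurable]: "?A t \<in> sets ?P" for t
    using adapted_stopping_greater[OF \<tau>, of t] past_subset by blast
  have "(\<integral>\<^sup>+\<omega>. (\<Sum>t. g (\<omega> (Suc t)) * indicator (?A t) \<omega>) \<partial>?P)
      = (\<Sum>t. \<integral>\<^sup>+\<omega>. g (\<omega> (Suc t)) * indicator (?A t) \<omega> \<partial>?P)"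
    by (rule nn_integral_suminf) measurable
  also have "\<dots> = (\<Sum>t. (\<integral>\<^sup>+x. g x \<partial>M) * emeasure ?P (?A t))"
    by (simp only: nn_integral_next_past[OF M g adapted_stopping_greater[OF \<tau>]])
  also have "\<dots> = (\<integral>\<^sup>+x. g x \<partial>M) * (\<integral>\<^sup>+\<omega>. ennreal_of_enat (\<tau> \<omega>) \<partial>?P)"
    by (simp only: nn_integral_enat_function[OF measurable_adapted_stopping[OF \<tau>]] ennreal_suminf_cmult)
  finally show ?thesis .
qed

text \<open>
  The information-theoretic core.  With \<open>S = X(\<omega> 1) + \<dots> + X(\<omega> \<tau>)\<close>, the change of measure on each
  \<open>{\<tau> = n}\<close> bounds the \<open>\<mu>\<close>-expectation of \<open>exp (- S)\<close> by the \<open>\<nu>\<close>-probability of stopping, hence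
  by \<open>\<alpha>\<close>.  Wald's identity gives \<open>S\<close> the expectation \<open>c = (p - q) T\<close>, so Jensen's inequality for \<open>exp\<close>
  yields \<open>exp (- c) \<le> \<alpha>\<close>.  Jensen's inequality enters through the tangent of \<open>exp\<close> at \<open>- c\<close>, with
  the sum \<open>U\<close> of the positive parts and the sum \<open>V\<close> of the negative parts of the summands on
  different sides, so that every integral is one of nonnegative functions.
\<close>

theorem expected_stopping_time_change_of_measure:
  fixes X :: "'a \<Rightarrow> real"
  assumes \<mu>: "prob_space \<mu>" and \<nu>: "prob_space \<nu>" and sets_eq: "sets \<nu> = sets \<mu>"
    and X [measurable]: "X \<in> borel_measurable \<mu>"
    and dominated: "\<And>k. k \<in> borel_measurable \<mu> \<Longrightarrow>
      (\<integral>\<^sup>+x. ennreal (exp (- X x)) * k x \<partial>\<mu>) \<le> (\<integral>\<^sup>+x. k x \<partial>\<nu>)"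
    and p: "(\<integral>\<^sup>+x. ennreal (X x) \<partial>\<mu>) = ennreal p"
    and q: "(\<integral>\<^sup>+x. ennreal (- X x) \<partial>\<mu>) = ennreal q"
    and "0 \<le> q" "q \<le> p"
    and \<tau>: "adapted_stopping \<mu> \<tau>"
    and \<alpha>: "emeasure (PiM {1..} (\<lambda>_. \<nu>)) {\<omega> \<in> space (PiM {1..} (\<lambda>_. \<nu>)). \<tau> \<omega> < \<infinity>} \<le> ennreal \<alpha>"
      "0 \<le> \<alpha>"
    and T: "(\<integral>\<^sup>+\<omega>. ennreal_of_enat (\<tau> \<omega>) \<partial>PiM {1..} (\<lambda>_. \<mu>)) = ennreal T" "0 \<le> T"
  shows "exp (- ((p - q) * T)) \<le> \<alpha>"
proof -
  let ?P = "PiM {1::nat..} (\<lambda>_. \<mu>)" and ?N = "PiM {1::nat..} (\<lambda>_. \<nu>)"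
  define c where "c = (p - q) * T"
  define A where "A n = {\<omega> \<in> space ?P. \<tau> \<omega> = enat n}" for n
  define S where "S n \<omega> = (\<Sum>i\<in>{1..n}. X (\<omega> i))" for n and \<omega> :: "nat \<Rightarrow> 'a"
  define L where "L \<omega> = (\<Sum>n. ennreal (exp (- S n \<omega>)) * indicator (A n) \<omega>)" for \<omega>
  define U where "U \<omega> = (\<Sum>t. ennreal (X (\<omega> (Suc t))) * indicator {\<omega> \<in> space ?P. enat t < \<tau> \<omega>} \<omega>)" for \<omega>
  define V where "V \<omega> = (\<Sum>t. ennreal (- X (\<omega> (Suc t))) * indicator {\<omega> \<in> space ?P. enat t < \<tau> \<omega>} \<omega>)" for \<omega>
  have nonneg: "0 \<le> p" "0 \<le> q" "0 \<le> T" "0 \<le> c"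
    using \<open>0 \<le> q\<close> \<open>q \<le> p\<close> \<open>0 \<le> T\<close> by (simp_all add: c_def)
  interpret P: prob_space ?P by (intro prob_space_PiM \<mu>)
  have \<tau>m [measurable]: "\<tau> \<in> measurable ?P (count_space UNIV)"
    by (rule measurable_adapted_stopping[OF \<tau>])
  have A: "A n \<in> past \<mu> n" for n using \<tau> by (simp add: A_def adapted_stopping_def)
  then have [measurable]: "A n \<in> sets ?P" for n using past_subset by blast
  have [measurable]: "S n \<in> borel_measurable ?P" for n unfolding S_def by measurable
  have [measurable]: "L \<in> borel_measurable ?P" "U \<in> borel_measurable ?P" "V \<in> borel_measurable ?P"
    unfolding L_def U_def V_def by measurable
  have sets_Pi: "sets ?N = sets ?P" by (intro sets_PiM_cong refl sets_eq)
  have spaces: "space ?N = space ?P" by (rule sets_eq_imp_space_eq[OF sets_Pi])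

  have "(\<integral>\<^sup>+\<omega>. L \<omega> \<partial>?P) = (\<Sum>n. \<integral>\<^sup>+\<omega>. ennreal (exp (- S n \<omega>)) * indicator (A n) \<omega> \<partial>?P)"
    unfolding L_def by (rule nn_integral_suminf) measurable
  also have "\<dots> = (\<Sum>n. \<integral>\<^sup>+\<omega>. (\<Prod>i\<in>{1..n}. ennreal (exp (- X (\<omega> i)))) * indicator (A n) \<omega> \<partial>?P)"
    by (simp add: S_def exp_sum prod_ennreal flip: sum_negf)
  also have "\<dots> \<le> (\<Sum>n. emeasure ?N (A n))"
    by (intro suminf_le nn_integral_past_dominated[OF \<mu> \<nu> sets_eq _ dominated A]) auto
  also have "\<dots> = emeasure ?N (\<Union>n. A n)"
  proof (rule suminf_emeasure)
    show "range A \<subseteq> sets ?N" unfolding sets_Pi using A past_subset by blast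
    show "disjoint_family A" by (auto simp: A_def disjoint_family_on_def)
  qed
  also have "(\<Union>n. A n) = {\<omega> \<in> space ?N. \<tau> \<omega> < \<infinity>}"
    unfolding spaces A_def enat_ord_simps(4) not_infinity_eq by blast
  finally have L: "(\<integral>\<^sup>+\<omega>. L \<omega> \<partial>?P) \<le> ennreal \<alpha>" using \<alpha> by simp

  have U: "(\<integral>\<^sup>+\<omega>. U \<omega> \<partial>?P) = ennreal (p * T)"
    unfolding U_def by (subst wald_nn_integral[OF \<mu> \<tau>]) (use nonneg in \<open>simp_all add: p T ennreal_mult' \<close>)
  have V: "(\<integral>\<^sup>+\<omega>. V \<omega> \<partial>?P) = ennreal (q * T)"
    unfolding V_def by (subst wald_nn_integral[OF \<mu> \<tau>]) (use nonneg in \<open>simp_all add: q T ennreal_mult' \<close>)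

  have "AE \<omega> in ?P. ennreal_of_enat (\<tau> \<omega>) \<noteq> \<infinity>"
    using T by (intro nn_integral_noteq_infinite) auto
  with AE_space have "AE \<omega> in ?P. ennreal (exp (- c) * (1 + c)) + ennreal (exp (- c)) * V \<omega>
      \<le> L \<omega> + ennreal (exp (- c)) * U \<omega>"
  proof eventually_elim
    case (elim \<omega>)
    note \<omega> = elim(1)
    from elim obtain n where n: "\<tau> \<omega> = enat n" by (cases "\<tau> \<omega>") auto
    have "L \<omega> = (\<Sum>k\<in>{n}. ennreal (exp (- S k \<omega>)) * indicator (A k) \<omega>)"
      unfolding L_def using n by (intro suminf_finite) (auto simp: A_def)
    then have L: "L \<omega> = ennreal (exp (- S n \<omega>))" using n \<omega> by (simp add: A_def)
    have stopped: "(\<Sum>t. ennreal (f (\<omega> (Suc t))) * indicator {\<omega> \<in> space ?P. enat t < \<tau> \<omega>} \<omega>)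
        = ennreal (\<Sum>i\<in>{1..n}. max 0 (f (\<omega> i)))" for f :: "'a \<Rightarrow> real"
    proof -
      have "(\<Sum>t. ennreal (f (\<omega> (Suc t))) * indicator {\<omega> \<in> space ?P. enat t < \<tau> \<omega>} \<omega>)
          = (\<Sum>t<n. ennreal (f (\<omega> (Suc t))) * indicator {\<omega> \<in> space ?P. enat t < \<tau> \<omega>} \<omega>)"
        using n by (intro suminf_finite) auto
      also have "\<dots> = (\<Sum>t<n. ennreal (max 0 (f (\<omega> (Suc t)))))"
        using n \<omega> by (intro sum.cong) (auto simp: max_def ennreal_neg)
      also have "\<dots> = (\<Sum>i\<in>{1..n}. ennreal (max 0 (f (\<omega> i))))"
        by (rule sum.reindex_bij_witness[of _ "\<lambda>i. i - 1" Suc]) auto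
      finally show ?thesis by (simp only: sum_ennreal[OF max.cobounded1])
    qed
    define u where "u = (\<Sum>i\<in>{1..n}. max 0 (X (\<omega> i)))"
    define v where "v = (\<Sum>i\<in>{1..n}. max 0 (- X (\<omega> i)))"
    have uv: "0 \<le> u" "0 \<le> v" by (auto simp: u_def v_def intro!: sum_nonneg)
    have S: "S n \<omega> = u - v"
      unfolding S_def u_def v_def sum_subtractf[symmetric] by (intro sum.cong) auto
    (* The tangent of exp at - c lies below the graph. *)
    have "1 + c - S n \<omega> \<le> exp (c - S n \<omega>)"
      using exp_ge_add_one_self[of "c - S n \<omega>"] by linarith
    then have "exp (- c) * (1 + c - S n \<omega>) \<le> exp (- c) * exp (c - S n \<omega>)"
      by (intro mult_left_mono) auto
    also have "\<dots> = exp (- S n \<omega>)" by (simp add: exp_add[symmetric])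
    finally have "exp (- c) * (1 + c) + exp (- c) * v \<le> exp (- S n \<omega>) + exp (- c) * u"
      unfolding S by (simp add: algebra_simps)
    then have "ennreal (exp (- c) * (1 + c) + exp (- c) * v) \<le> ennreal (exp (- S n \<omega>) + exp (- c) * u)"
      by (rule ennreal_leI)
    then show "ennreal (exp (- c) * (1 + c)) + ennreal (exp (- c)) * V \<omega>
        \<le> L \<omega> + ennreal (exp (- c)) * U \<omega>"
      using nonneg uv unfolding L U_def V_def stopped[of X] stopped[of "\<lambda>x. - X x"] u_def[symmetric] v_def[symmetric]
      by (simp add: ennreal_plus ennreal_mult')
  qed
  then have "(\<integral>\<^sup>+\<omega>. ennreal (exp (- c) * (1 + c)) + ennreal (exp (- c)) * V \<omega> \<partial>?P)
      \<le> (\<integral>\<^sup>+\<omega>. L \<omega> + ennreal (exp (- c)) * U \<omega> \<partial>?P)"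
    by (rule nn_integral_mono_AE)
  then have "ennreal (exp (- c) * (1 + c)) + ennreal (exp (- c)) * ennreal (q * T)
      \<le> (\<integral>\<^sup>+\<omega>. L \<omega> \<partial>?P) + ennreal (exp (- c)) * ennreal (p * T)"
    by (simp add: nn_integral_add nn_integral_cmult U V P.emeasure_space_1)
  also have "\<dots> \<le> ennreal \<alpha> + ennreal (exp (- c)) * ennreal (p * T)"
    using L by (intro add_right_mono)
  finally have "ennreal (exp (- c) * (1 + c) + exp (- c) * (q * T)) \<le> ennreal (\<alpha> + exp (- c) * (p * T))"
    using nonneg \<open>0 \<le> \<alpha>\<close> by (simp add: ennreal_plus ennreal_mult' del: ennreal_le_iff)
  then have "exp (- c) * (1 + c) + exp (- c) * (q * T) \<le> \<alpha> + exp (- c) * (p * T)"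
    using nonneg \<open>0 \<le> \<alpha>\<close> by (subst (asm) ennreal_le_iff) auto
  then have "exp (- c) \<le> \<alpha>" unfolding c_def by (simp add: algebra_simps)
  then show ?thesis by (simp add: c_def)
qed

section \<open>Existence of a log-optimal mixture\<close>

definition mix :: "nat \<Rightarrow> (nat \<Rightarrow> real) \<Rightarrow> (nat \<Rightarrow> real) \<Rightarrow> real" where
  "mix d l x = (\<Sum>j=0..d. l j * x j)"

lemma space_vec_space:
  "space (vec_space d) = {x \<in> extensional {0..d}. x 0 = 1 \<and> (\<forall>j\<in>{0..d}. 0 \<le> x j)}"
  by (auto simp: vec_space_def space_restrict_space space_PiM PiE_def)

lemma measurable_coordinate [measurable]:
  "j \<in> {0..d} \<Longrightarrow> (\<lambda>x. x j) \<in> borel_measurable (vec_space d)"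
  unfolding vec_space_def by (intro measurable_restrict_space1 measurable_component_singleton)

lemma measurable_mix [measurable]: "mix d l \<in> borel_measurable (vec_space d)"
  unfolding mix_def by (intro borel_measurable_sum borel_measurable_times) auto

lemma measurable_elog [measurable]: "elog \<in> borel_measurable borel"
  unfolding elog_def[abs_def] by measurable

lemma mix_nonneg: "l \<in> prob_simplex d \<Longrightarrow> x \<in> space (vec_space d) \<Longrightarrow> 0 \<le> mix d l x"
  by (auto simp: mix_def prob_simplex_def space_vec_space intro!: sum_nonneg mult_nonneg_nonneg)

lemma total_ge_1: "x \<in> space (vec_space d) \<Longrightarrow> 1 \<le> (\<Sum>j=0..d. x j)"
  using member_le_sum[of 0 "{0..d}" x] by (auto simp: space_vec_space)

lemma mix_le_total:
  "l \<in> prob_simplex d \<Longrightarrow> x \<in> space (vec_space d) \<Longrightarrow> mix d l x \<le> (\<Sum>j=0..d. x j)"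
  by (auto simp: mix_def prob_simplex_def space_vec_space intro!: sum_mono mult_left_le_one_le)

text \<open>
  Sequential compactness of the simplex.  Its members equal \<open>undefined\<close> outside \<open>{0..d}\<close>, so it lies
  in a product of compact sets over all indices and Tychonoff's theorem applies.
\<close>

lemma prob_simplex_limit:
  assumes "\<And>n. u n \<in> prob_simplex d"
  obtains l r where "l \<in> prob_simplex d" "strict_mono (r :: nat \<Rightarrow> nat)"
    "\<And>j. (\<lambda>n. u (r n) j) \<longlonglongrightarrow> l j"
proof -
  let ?K = "PiE UNIV (\<lambda>j. if j \<in> {0..d} then {0..1} else {undefined :: real})"
  have "compact ?K"
    using compactin_PiE[of "\<lambda>_. euclidean" UNIV "\<lambda>j. if j \<in> {0..d} then {0..1} else {undefined :: real}"]
    by (simp add: euclidean_product_topology)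
  moreover have uK: "u n \<in> ?K" for n
    using assms[of n] by (auto simp: prob_simplex_def PiE_def Pi_def extensional_def)
  ultimately obtain l r where l: "l \<in> ?K" and r: "strict_mono (r :: nat \<Rightarrow> nat)"
    and lim: "(u \<circ> r) \<longlonglongrightarrow> l"
    unfolding compact_eq_seq_compact_metric seq_compact_def by meson
  have coord: "(\<lambda>n. u (r n) j) \<longlonglongrightarrow> l j" for j
  proof -
    have "continuous_on UNIV (\<lambda>x::nat \<Rightarrow> real. x j)"
      by (rule continuous_on_product_then_coordinatewise) (rule continuous_on_id)
    then have "isCont (\<lambda>x::nat \<Rightarrow> real. x j) l"
      using continuous_on_eq_continuous_at[OF open_UNIV] by blast
    from isCont_tendsto_compose[OF this lim] show ?thesis by simp
  qed
  have "(\<Sum>j=0..d. l j) = 1"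
  proof (rule LIMSEQ_unique)
    show "(\<lambda>n. \<Sum>j=0..d. u (r n) j) \<longlonglongrightarrow> (\<Sum>j=0..d. l j)" by (intro tendsto_sum coord)
    show "(\<lambda>n. \<Sum>j=0..d. u (r n) j) \<longlonglongrightarrow> 1" using assms by (simp add: prob_simplex_def)
  qed
  moreover have "l \<in> PiE {0..d} (\<lambda>_. {0..1})"
    using l by (auto simp: PiE_def Pi_def extensional_def split: if_splits)
  ultimately have "l \<in> prob_simplex d" by (simp add: prob_simplex_def)
  with r coord show ?thesis using that by blast
qed

lemma tendsto_elog:
  assumes "y \<longlonglongrightarrow> z" and nonneg: "\<And>n. 0 \<le> y n"
  shows "(\<lambda>n. elog (y n)) \<longlonglongrightarrow> elog z"
proof (cases "z = 0")
  case False
  moreover have "0 \<le> z" using assms by (intro LIMSEQ_le_const) auto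
  ultimately have "0 < z" by simp
  have "(\<lambda>n. ereal (ln (y n))) \<longlonglongrightarrow> ereal (ln z)"
    using assms(1) \<open>0 < z\<close> by (intro tendsto_ereal tendsto_ln) auto
  moreover have "\<forall>\<^sub>F n in sequentially. ereal (ln (y n)) = elog (y n)"
    using order_tendstoD(1)[OF assms(1) \<open>0 < z\<close>] by eventually_elim (simp add: elog_def)
  ultimately have "(\<lambda>n. elog (y n)) \<longlonglongrightarrow> ereal (ln z)"
    by (rule Lim_transform_eventually)
  then show ?thesis using False by (simp add: elog_def)
next
  case True
  have "\<forall>\<^sub>F n in sequentially. elog (y n) < ereal r" for r
  proof -
    have "\<forall>\<^sub>F n in sequentially. y n < exp r"
      using order_tendstoD(2)[OF assms(1)] True by simp
    then show ?thesis
    proof eventually_elim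
      case (elim n)
      then show ?case using nonneg[of n] ln_less_cancel_iff[of "y n" "exp r"]
        by (cases "y n = 0") (auto simp: elog_def)
    qed
  qed
  then show ?thesis using True by (simp add: elog_def tendsto_MInfty)
qed

text \<open>
  The gap between \<open>log (mix d l x)\<close> and its upper bound \<open>log (\<Sum>j. x j)\<close>, which is independent of \<open>l\<close>.
  The gap is nonnegative with values in \<open>[0, \<infinity>]\<close>, so Fatou's lemma applies to it directly.
\<close>

definition log_deficit :: "nat \<Rightarrow> (nat \<Rightarrow> real) \<Rightarrow> (nat \<Rightarrow> real) \<Rightarrow> ennreal" where
  "log_deficit d l x = e2ennreal (ereal (ln (\<Sum>j=0..d. x j)) - elog (mix d l x))"

lemma measurable_log_deficit [measurable]: "log_deficit d l \<in> borel_measurable (vec_space d)"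
  unfolding log_deficit_def[abs_def] by measurable

lemma tendsto_log_deficit:
  assumes "\<And>j. (\<lambda>n. u n j) \<longlonglongrightarrow> l j" and "\<And>n. u n \<in> prob_simplex d" and "x \<in> space (vec_space d)"
  shows "(\<lambda>n. log_deficit d (u n) x) \<longlonglongrightarrow> log_deficit d l x"
proof -
  have "(\<lambda>n. mix d (u n) x) \<longlonglongrightarrow> mix d l x"
    unfolding mix_def using assms(1) by (intro tendsto_sum tendsto_mult tendsto_const) auto
  then have "(\<lambda>n. elog (mix d (u n) x)) \<longlonglongrightarrow> elog (mix d l x)"
    using assms(2,3) by (intro tendsto_elog mix_nonneg)
  then show ?thesis
    unfolding log_deficit_def
    by (intro tendsto_e2ennrealI tendsto_diff_ereal_general tendsto_const) auto
qed

lemma log_deficit_balance: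
  assumes "l \<in> prob_simplex d" "x \<in> space (vec_space d)"
  shows "e2ennreal (- elog (mix d l x)) + ennreal (ln (\<Sum>j=0..d. x j))
    = log_deficit d l x + e2ennreal (elog (mix d l x))"
proof (cases "mix d l x = 0")
  case True
  then show ?thesis by (simp add: log_deficit_def elog_def e2ennreal_neg)
next
  case False
  define m s where "m = ln (mix d l x)" and "s = ln (\<Sum>j=0..d. x j)"
  have "0 < mix d l x" using False mix_nonneg[OF assms] by simp
  then have "m \<le> s" "0 \<le> s" unfolding m_def s_def
    using mix_le_total[OF assms] total_ge_1[OF assms(2)] by auto
  then have "ennreal (- m) + ennreal s = ennreal (s - m) + ennreal m"
    by (cases "0 \<le> m") (auto simp: ennreal_neg simp flip: ennreal_plus)
  then show ?thesis using False by (simp add: log_deficit_def elog_def m_def s_def)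
qed

text \<open>
  If the upper bound is integrable, maximising the expected logarithm means minimising the
  expected deficit, with both sides allowed to be infinite.
\<close>

lemma ext_expectation_eq_total_minus_deficit:
  assumes [measurable_cong]: "sets \<mu> = sets (vec_space d)" and l: "l \<in> prob_simplex d"
    and total: "(\<integral>\<^sup>+x. ennreal (ln (\<Sum>j=0..d. x j)) \<partial>\<mu>) < \<infinity>"
  shows "ext_expectation \<mu> (\<lambda>x. elog (mix d l x))
    = enn2ereal (\<integral>\<^sup>+x. ennreal (ln (\<Sum>j=0..d. x j)) \<partial>\<mu>) - enn2ereal (\<integral>\<^sup>+x. log_deficit d l x \<partial>\<mu>)"
proof -
  have sp: "space \<mu> = space (vec_space d)" by (rule sets_eq_imp_space_eq) fact
  let ?N = "\<integral>\<^sup>+x. e2ennreal (- elog (mix d l x)) \<partial>\<mu>" and ?P = "\<integral>\<^sup>+x. e2ennreal (elog (mix d l x)) \<partial>\<mu>"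
    and ?T = "\<integral>\<^sup>+x. ennreal (ln (\<Sum>j=0..d. x j)) \<partial>\<mu>" and ?D = "\<integral>\<^sup>+x. log_deficit d l x \<partial>\<mu>"
  have "?N + ?T = (\<integral>\<^sup>+x. e2ennreal (- elog (mix d l x)) + ennreal (ln (\<Sum>j=0..d. x j)) \<partial>\<mu>)"
    by (rule nn_integral_add[symmetric]) measurable
  also have "\<dots> = (\<integral>\<^sup>+x. log_deficit d l x + e2ennreal (elog (mix d l x)) \<partial>\<mu>)"
    by (intro nn_integral_cong log_deficit_balance l) (simp add: sp)
  also have "\<dots> = ?D + ?P" by (rule nn_integral_add) measurable
  finally have eq: "?N + ?T = ?D + ?P" .
  have "?P \<le> ?T"
  proof (rule nn_integral_mono)
    fix x assume "x \<in> space \<mu>"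
    then have x: "x \<in> space (vec_space d)" by (simp add: sp)
    show "e2ennreal (elog (mix d l x)) \<le> ennreal (ln (\<Sum>j=0..d. x j))"
      using mix_nonneg[OF l x] mix_le_total[OF l x] by (auto simp: elog_def e2ennreal_neg intro!: ennreal_leI)
  qed
  with total have "?P < \<infinity>" by (rule le_less_trans[rotated])
  then obtain p t where p: "?P = ennreal p" "0 \<le> p" and t: "?T = ennreal t" "0 \<le> t"
    using total by (cases ?P; cases ?T) auto
  show ?thesis
  proof (cases ?N)
    case N: (real n)
    moreover from this eq p t have "?D \<noteq> top" by (auto simp flip: ennreal_plus)
    then obtain e where e: "?D = ennreal e" "0 \<le> e" by (cases ?D) auto
    ultimately have "ennreal (n + t) = ennreal (e + p)" using eq p t by simp
    then have "n + t = e + p" using N e p t by (subst (asm) ennreal_inj) auto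
    then show ?thesis unfolding ext_expectation_def using N e p t by (simp add: enn2ereal_ennreal)
  next
    case top
    with eq have "?D + ?P = top" by simp
    with p have "?D = top" by (simp add: ennreal_add_eq_top)
    with top p t show ?thesis by (simp add: ext_expectation_def enn2ereal_ennreal)
  qed
qed

text \<open>
  If \<open>log (\<Sum>j. x j)\<close> is integrable, the expected deficit
  is lower semicontinuous in \<open>l\<close> by Fatou's lemma and has a minimum on the compact simplex.
  Otherwise the uniform mixture loses only the constant \<open>log (d + 1)\<close> against the total
  and already has expected logarithm \<open>\<infinity>\<close>.
\<close>

lemma log_optimal_mixture_exists:
  assumes "prob_space \<mu>" and sets_\<mu> [measurable_cong]: "sets \<mu> = sets (vec_space d)"
  obtains l where "l \<in> prob_simplex d"
    "\<And>l'. l' \<in> prob_simplex d \<Longrightarrow>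
      ext_expectation \<mu> (\<lambda>x. elog (mix d l' x)) \<le> ext_expectation \<mu> (\<lambda>x. elog (mix d l x))"
proof (cases "(\<integral>\<^sup>+x. ennreal (ln (\<Sum>j=0..d. x j)) \<partial>\<mu>) < \<infinity>")
  case True
  have sp: "space \<mu> = space (vec_space d)" by (rule sets_eq_imp_space_eq) fact
  let ?J = "\<lambda>l. \<integral>\<^sup>+x. log_deficit d l x \<partial>\<mu>"
  have "(\<lambda>j\<in>{0..d}. if j = 0 then 1 else 0) \<in> prob_simplex d"
    by (auto simp: prob_simplex_def sum.delta)
  then have "?J ` prob_simplex d \<noteq> {}" by blast
  then obtain v where v: "\<And>n. v n \<in> ?J ` prob_simplex d" "v \<longlonglongrightarrow> Inf (?J ` prob_simplex d)"
    using Inf_as_limit[of "?J ` prob_simplex d"] by auto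
  from v(1) have "\<forall>n. \<exists>l. l \<in> prob_simplex d \<and> v n = ?J l" by auto
  then obtain u where u: "\<And>n. u n \<in> prob_simplex d" "\<And>n. v n = ?J (u n)"
    using choice[of "\<lambda>n l. l \<in> prob_simplex d \<and> v n = ?J l"] by auto
  obtain l r where l: "l \<in> prob_simplex d" and r: "strict_mono (r :: nat \<Rightarrow> nat)"
    and lim: "\<And>j. (\<lambda>n. u (r n) j) \<longlonglongrightarrow> l j"
    using prob_simplex_limit[of u d] u(1) by blast
  have "?J l = (\<integral>\<^sup>+x. liminf (\<lambda>n. log_deficit d (u (r n)) x) \<partial>\<mu>)"
    using tendsto_log_deficit[of "\<lambda>n. u (r n)", OF lim u(1)]
    by (intro nn_integral_cong lim_imp_Liminf[symmetric]) (simp_all add: sp)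
  also have "\<dots> \<le> liminf (\<lambda>n. ?J (u (r n)))"
    by (rule nn_integral_liminf) measurable
  also have "\<dots> = Inf (?J ` prob_simplex d)"
    using LIMSEQ_subseq_LIMSEQ[OF v(2) r] by (simp add: lim_imp_Liminf o_def u(2))
  finally have min: "?J l \<le> ?J l'" if "l' \<in> prob_simplex d" for l'
    using that by (meson INF_lower order_trans)
  show ?thesis
  proof (rule that[OF l])
    fix l' assume l': "l' \<in> prob_simplex d"
    then show "ext_expectation \<mu> (\<lambda>x. elog (mix d l' x)) \<le> ext_expectation \<mu> (\<lambda>x. elog (mix d l x))"
      unfolding ext_expectation_eq_total_minus_deficit[OF sets_\<mu> l' True]
        ext_expectation_eq_total_minus_deficit[OF sets_\<mu> l True]
      by (intro ereal_minus_mono order_refl) (simp add: min less_eq_ennreal.rep_eq[symmetric])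
  qed
next
  case False
  interpret prob_space \<mu> by fact
  have sp: "space \<mu> = space (vec_space d)" by (rule sets_eq_imp_space_eq) fact
  let ?l = "\<lambda>j\<in>{0..d}. 1 / real (Suc d)"
  have l: "?l \<in> prob_simplex d" by (auto simp: prob_simplex_def)
  have "\<infinity> = (\<integral>\<^sup>+x. ennreal (ln (\<Sum>j=0..d. x j)) \<partial>\<mu>)" 
    using False unfolding infinity_ennreal_def top.not_eq_extremum[symmetric] by simp
  also have "\<dots> \<le> (\<integral>\<^sup>+x. e2ennreal (elog (mix d ?l x)) + ennreal (ln (real (Suc d))) \<partial>\<mu>)"
  proof (rule nn_integral_mono)
    fix x assume "x \<in> space \<mu>"
    then have s: "1 \<le> (\<Sum>j=0..d. x j)" using total_ge_1 by (simp add: sp)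
    have "mix d ?l x = (\<Sum>j=0..d. x j) / real (Suc d)"
      unfolding mix_def sum_divide_distrib by (intro sum.cong) auto
    then have "e2ennreal (elog (mix d ?l x)) = ennreal (ln (\<Sum>j=0..d. x j) - ln (real (Suc d)))"
      using s by (simp add: elog_def ln_div)
    then show "ennreal (ln (\<Sum>j=0..d. x j)) \<le> e2ennreal (elog (mix d ?l x)) + ennreal (ln (real (Suc d)))"
      using ennreal_leI[of "ln (\<Sum>j=0..d. x j)" "max 0 (ln (\<Sum>j=0..d. x j) - ln (real (Suc d))) + ln (real (Suc d))"]
      by (simp add: ennreal_plus)
  qed
  also have "\<dots> = (\<integral>\<^sup>+x. e2ennreal (elog (mix d ?l x)) \<partial>\<mu>) + ennreal (ln (real (Suc d)))"
    by (subst nn_integral_add) (auto simp: emeasure_space_1)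
  finally have "(\<integral>\<^sup>+x. e2ennreal (elog (mix d ?l x)) \<partial>\<mu>) = \<infinity>"
    by (simp add: top_unique ennreal_add_eq_top)
  then have "ext_expectation \<mu> (\<lambda>x. elog (mix d ?l x)) = \<infinity>"
    by (simp add: ext_expectation_def)
  then show ?thesis using l by (intro that[of ?l]) auto
qed

section \<open>First-order optimality and the induced null law\<close>

lemma AE_mix_pos:
  assumes sets_\<mu> [measurable_cong]: "sets \<mu> = sets (vec_space d)" and l: "l \<in> prob_simplex d"
    and finite: "(\<integral>\<^sup>+x. e2ennreal (- elog (mix d l x)) \<partial>\<mu>) \<noteq> \<infinity>"
  shows "AE x in \<mu>. x \<in> space (vec_space d) \<and> 0 < mix d l x"
proof -
  have sp: "space \<mu> = space (vec_space d)" by (rule sets_eq_imp_space_eq) fact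
  have "AE x in \<mu>. e2ennreal (- elog (mix d l x)) \<noteq> \<infinity>"
    using finite by (intro nn_integral_noteq_infinite) auto
  with AE_space show ?thesis
  proof eventually_elim
    case (elim x)
    then show ?case using mix_nonneg[OF l, of x] by (cases "mix d l x = 0") (auto simp: sp elog_def)
  qed
qed

text \<open>
  Moving the maximiser \<open>l\<close> towards the vertex \<open>j\<close>, to \<open>(l + \<delta> e\<^sub>j) / (1 + \<delta>)\<close>, changes the logarithm by exactly
  \<open>log (1 + \<delta> R) - log (1 + \<delta>)\<close> with \<open>R = x j / mix d l x\<close>; optimality says that this change has
  nonpositive expectation.  The ratio is written with \<open>exp (- ln _)\<close>, which is positive even where the mixture
  vanishes.
\<close>

lemma log_optimal_perturbation:
  fixes \<delta> :: real
  assumes \<mu>: "prob_space \<mu>" and sets_\<mu> [measurable_cong]: "sets \<mu> = sets (vec_space d)"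
    and l: "l \<in> prob_simplex d"
    and optimal: "\<And>l'. l' \<in> prob_simplex d \<Longrightarrow>
      ext_expectation \<mu> (\<lambda>x. elog (mix d l' x)) \<le> ext_expectation \<mu> (\<lambda>x. elog (mix d l x))"
    and p: "(\<integral>\<^sup>+x. e2ennreal (elog (mix d l x)) \<partial>\<mu>) = ennreal p" "0 \<le> p"
    and q: "(\<integral>\<^sup>+x. e2ennreal (- elog (mix d l x)) \<partial>\<mu>) = ennreal q" "0 \<le> q"
    and j: "j \<in> {0..d}" and \<delta>: "0 < \<delta>"
  shows "(\<integral>\<^sup>+x. ennreal (ln (1 + \<delta> * (x j * exp (- ln (mix d l x))))) \<partial>\<mu>) \<le> ennreal (ln (1 + \<delta>))"
proof -
  interpret prob_space \<mu> by fact
  have sp: "space \<mu> = space (vec_space d)" by (rule sets_eq_imp_space_eq) fact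
  have [measurable]: "(\<lambda>x. x j) \<in> borel_measurable (vec_space d)"
    using j by (rule measurable_coordinate)
  define l' where "l' = (\<lambda>i\<in>{0..d}. (l i + (if i = j then \<delta> else 0)) / (1 + \<delta>))"
  have range_l: "0 \<le> l i" "l i \<le> 1" if "i \<in> {0..d}" for i
    using l that by (auto simp: prob_simplex_def)
  have "(\<Sum>i=0..d. l' i) = ((\<Sum>i=0..d. l i) + (\<Sum>i=0..d. if i = j then \<delta> else 0)) / (1 + \<delta>)"
    unfolding l'_def sum.distrib[symmetric] sum_divide_distrib by (intro sum.cong) auto
  also have "\<dots> = 1" using j \<delta> l by (simp add: prob_simplex_def)
  finally have "(\<Sum>i=0..d. l' i) = 1" .
  moreover have "0 \<le> l' i \<and> l' i \<le> 1" if "i \<in> {0..d}" for i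
    using range_l[OF that] \<delta> that by (auto simp: l'_def)
  ultimately have l': "l' \<in> prob_simplex d"
    by (auto simp: prob_simplex_def l'_def)
  have mix_l': "mix d l' x = (mix d l x + \<delta> * x j) / (1 + \<delta>)" for x
  proof -
    have "mix d l' x = ((\<Sum>i=0..d. l i * x i) + (\<Sum>i=0..d. (if i = j then \<delta> * x i else 0))) / (1 + \<delta>)"
      unfolding mix_def l'_def sum.distrib[symmetric] sum_divide_distrib
      by (intro sum.cong) (auto simp: algebra_simps)
    then show ?thesis using j by (simp add: mix_def)
  qed
  let ?P = "\<lambda>l x. e2ennreal (elog (mix d l x))" and ?N = "\<lambda>l x. e2ennreal (- elog (mix d l x))"
    and ?G = "\<lambda>x. ennreal (ln (1 + \<delta> * (x j * exp (- ln (mix d l x)))))"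
  have "AE x in \<mu>. x \<in> space (vec_space d) \<and> 0 < mix d l x"
    using q by (intro AE_mix_pos[OF sets_\<mu> l]) simp
  (* At such x all quantities are finite, so the integrals of positive and negative parts may be
     compared by an identity without subtraction. *)
  then have balance: "AE x in \<mu>. ?P l x + ?G x + ?N l' x = ?P l' x + ?N l x + ennreal (ln (1 + \<delta>))
    \<and> ?N l' x \<le> ?N l x + ennreal (ln (1 + \<delta>))"
  proof eventually_elim
    case (elim x)
    define m R where "m = mix d l x" and "R = x j * exp (- ln m)"
    have "0 < m" and "0 \<le> x j" using elim j by (auto simp: m_def space_vec_space)
    then have "0 \<le> R" by (simp add: R_def)
    have "m * R = x j" using \<open>0 < m\<close> by (simp add: R_def exp_minus)
    then have "m * (1 + \<delta> * R) = m + \<delta> * x j" by (auto simp: algebra_simps)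
    then have "mix d l' x = m * (1 + \<delta> * R) / (1 + \<delta>)" by (simp add: mix_l' m_def)
    moreover have pos: "0 < 1 + \<delta> * R" using \<open>0 \<le> R\<close> \<delta> by (intro add_pos_nonneg) auto
    then have "0 < m * (1 + \<delta> * R) / (1 + \<delta>)" using \<open>0 < m\<close> \<delta> by simp
    moreover have "ln (m * (1 + \<delta> * R) / (1 + \<delta>)) = ln m + ln (1 + \<delta> * R) - ln (1 + \<delta>)"
      using \<open>0 < m\<close> pos \<delta> by (simp add: ln_mult ln_div)
    ultimately have e: "elog (mix d l' x) = ereal (ln m + ln (1 + \<delta> * R) - ln (1 + \<delta>))"
      "elog (mix d l x) = ereal (ln m)"
      using \<open>0 < m\<close> by (auto simp: elog_def m_def)
    define a b c where "a = ln m" and "b = ln (1 + \<delta> * R)" and "c = ln (1 + \<delta>)"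
    have "0 \<le> b" "0 \<le> c" using \<open>0 \<le> R\<close> \<delta> by (auto simp: b_def c_def)
    have "max 0 a + b + max 0 (- (a + b - c)) = max 0 (a + b - c) + max 0 (- a) + c" by auto
    then have "ennreal (max 0 a + b + max 0 (- (a + b - c))) = ennreal (max 0 (a + b - c) + max 0 (- a) + c)"
      by (rule arg_cong)
    moreover have "ennreal (max 0 (- (a + b - c))) \<le> ennreal (max 0 (- a) + c)"
      using \<open>0 \<le> b\<close> \<open>0 \<le> c\<close> by (intro ennreal_leI) auto
    ultimately show ?case
      using \<open>0 \<le> b\<close> \<open>0 \<le> c\<close> unfolding e unfolding m_def[symmetric] R_def[symmetric]
      by (simp add: a_def[symmetric] b_def[symmetric] c_def[symmetric] ennreal_plus)
  qed
  have "(\<integral>\<^sup>+x. ?P l x + ?G x + ?N l' x \<partial>\<mu>) = (\<integral>\<^sup>+x. ?P l' x + ?N l x + ennreal (ln (1 + \<delta>)) \<partial>\<mu>)"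
    using balance by (intro nn_integral_cong_AE) auto
  then have eq: "ennreal p + (\<integral>\<^sup>+x. ?G x \<partial>\<mu>) + (\<integral>\<^sup>+x. ?N l' x \<partial>\<mu>)
      = (\<integral>\<^sup>+x. ?P l' x \<partial>\<mu>) + ennreal q + ennreal (ln (1 + \<delta>))"
    by (simp add: nn_integral_add p q emeasure_space_1)
  have "(\<integral>\<^sup>+x. ?N l' x \<partial>\<mu>) \<le> (\<integral>\<^sup>+x. ?N l x + ennreal (ln (1 + \<delta>)) \<partial>\<mu>)"
    using balance by (intro nn_integral_mono_AE) auto
  also have "\<dots> < \<infinity>" by (simp add: nn_integral_add q emeasure_space_1)
  finally obtain n where n: "(\<integral>\<^sup>+x. ?N l' x \<partial>\<mu>) = ennreal n" "0 \<le> n"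
    by (cases "\<integral>\<^sup>+x. ?N l' x \<partial>\<mu>") auto
  have le: "enn2ereal (\<integral>\<^sup>+x. ?P l' x \<partial>\<mu>) - ereal n \<le> ereal (p - q)"
    using optimal[OF l'] p q n by (simp add: ext_expectation_def enn2ereal_ennreal)
  then obtain r where r: "(\<integral>\<^sup>+x. ?P l' x \<partial>\<mu>) = ennreal r" "0 \<le> r"
    by (cases "\<integral>\<^sup>+x. ?P l' x \<partial>\<mu>") auto
  have "r - n \<le> p - q" using le r by (simp add: enn2ereal_ennreal)
  have "0 \<le> ln (1 + \<delta>)" using \<delta> by simp
  have "(\<integral>\<^sup>+x. ?G x \<partial>\<mu>) \<noteq> top" using eq[symmetric] r by (auto simp: ennreal_add_eq_top)
  then obtain g where g: "(\<integral>\<^sup>+x. ?G x \<partial>\<mu>) = ennreal g" "0 \<le> g" by (cases "\<integral>\<^sup>+x. ?G x \<partial>\<mu>") auto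
  have "ennreal (p + g + n) = ennreal (r + q + ln (1 + \<delta>))"
    using eq g n r p q \<open>0 \<le> ln (1 + \<delta>)\<close> by (simp add: ennreal_plus)
  then have "p + g + n = r + q + ln (1 + \<delta>)"
    using g n r p q \<open>0 \<le> ln (1 + \<delta>)\<close> by (subst (asm) ennreal_inj) auto
  then have "g \<le> ln (1 + \<delta>)" using \<open>r - n \<le> p - q\<close> by simp
  then show ?thesis unfolding g by (rule ennreal_leI)
qed

text \<open>
  First-order optimality of the log-optimal mixture: relative to it every coordinate has expectation at
  most \<open>1\<close>.  Divide the perturbation bound by \<open>\<delta> = 1 / (n + 1)\<close> and let \<open>n\<close> tend to infinity.
  The minorant \<open>y / (1 + y) \<le> log (1 + y)\<close> makes the pointwise limit elementary, and Fatou's lemma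
  passes to the expectation.
\<close>

lemma log_optimal_numeraire:
  assumes \<mu>: "prob_space \<mu>" and sets_\<mu> [measurable_cong]: "sets \<mu> = sets (vec_space d)"
    and l: "l \<in> prob_simplex d"
    and optimal: "\<And>l'. l' \<in> prob_simplex d \<Longrightarrow>
      ext_expectation \<mu> (\<lambda>x. elog (mix d l' x)) \<le> ext_expectation \<mu> (\<lambda>x. elog (mix d l x))"
    and p: "(\<integral>\<^sup>+x. e2ennreal (elog (mix d l x)) \<partial>\<mu>) = ennreal p" "0 \<le> p"
    and q: "(\<integral>\<^sup>+x. e2ennreal (- elog (mix d l x)) \<partial>\<mu>) = ennreal q" "0 \<le> q"
    and j: "j \<in> {0..d}"
  shows "(\<integral>\<^sup>+x. ennreal (exp (- ln (mix d l x))) * ennreal (x j) \<partial>\<mu>) \<le> 1"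
proof -
  have sp: "space \<mu> = space (vec_space d)" by (rule sets_eq_imp_space_eq) fact
  have [measurable]: "(\<lambda>x. x j) \<in> borel_measurable (vec_space d)"
    using j by (rule measurable_coordinate)
  define R where "R x = x j * exp (- ln (mix d l x))" for x
  have [measurable]: "R \<in> borel_measurable \<mu>" unfolding R_def by measurable
  have R: "0 \<le> R x" if "x \<in> space \<mu>" for x
    using that j by (auto simp: R_def sp space_vec_space)
  have bound: "(\<integral>\<^sup>+x. ennreal (R x / (1 + R x / real (Suc n))) \<partial>\<mu>) \<le> 1" for n
  proof -
    define \<delta> where "\<delta> = 1 / real (Suc n)"
    have \<delta>: "0 < \<delta>" "real (Suc n) * \<delta> = 1" by (simp_all add: \<delta>_def)
    have "(\<integral>\<^sup>+x. ennreal (R x / (1 + R x / real (Suc n))) \<partial>\<mu>)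
        \<le> (\<integral>\<^sup>+x. ennreal (real (Suc n)) * ennreal (ln (1 + \<delta> * R x)) \<partial>\<mu>)"
    proof (rule nn_integral_mono)
      fix x assume "x \<in> space \<mu>"
      then have "0 \<le> \<delta> * R x" using R \<delta> by simp
      define y where "y = \<delta> * R x"
      have "0 \<le> y" unfolding y_def by fact
      have "ln (1 / (1 + y)) \<le> 1 / (1 + y) - 1"
        using \<open>0 \<le> y\<close> by (intro ln_le_minus_one) auto
      then have "y / (1 + y) \<le> ln (1 + y)"
        using \<open>0 \<le> y\<close> by (simp add: ln_div field_simps)
      then have "real (Suc n) * (y / (1 + y)) \<le> real (Suc n) * ln (1 + y)"
        by (rule mult_left_mono) simp
      moreover have "real (Suc n) * (y / (1 + y)) = R x / (1 + R x / real (Suc n))"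
        unfolding times_divide_eq_right y_def by (simp add: \<delta>_def)
      ultimately show "ennreal (R x / (1 + R x / real (Suc n)))
          \<le> ennreal (real (Suc n)) * ennreal (ln (1 + \<delta> * R x))"
        using \<open>0 \<le> y\<close> unfolding y_def[symmetric] by (subst ennreal_mult'[symmetric]) (auto intro: ennreal_leI)
    qed
    also have "\<dots> = ennreal (real (Suc n)) * (\<integral>\<^sup>+x. ennreal (ln (1 + \<delta> * R x)) \<partial>\<mu>)"
      by (rule nn_integral_cmult) measurable
    also have "\<dots> \<le> ennreal (real (Suc n)) * ennreal (ln (1 + \<delta>))"
      unfolding R_def by (intro mult_left_mono log_optimal_perturbation[OF \<mu> sets_\<mu> l optimal p q j \<delta>(1)]) auto
    also have "\<dots> \<le> ennreal (real (Suc n) * \<delta>)"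
      using ln_add_one_self_le_self[of \<delta>] \<delta>(1)
      by (subst ennreal_mult'[symmetric]) (auto intro!: ennreal_leI mult_left_mono)
    finally show ?thesis using \<delta> by simp
  qed
  have "(\<integral>\<^sup>+x. ennreal (R x) \<partial>\<mu>) = (\<integral>\<^sup>+x. liminf (\<lambda>n. ennreal (R x / (1 + R x / real (Suc n)))) \<partial>\<mu>)"
  proof (intro nn_integral_cong lim_imp_Liminf[symmetric] tendsto_ennrealI)
    fix x
    have "(\<lambda>n. R x / (1 + R x * inverse (real (Suc n)))) \<longlonglongrightarrow> R x / (1 + R x * 0)"
      by (intro tendsto_intros LIMSEQ_inverse_real_of_nat) auto
    then show "(\<lambda>n. R x / (1 + R x / real (Suc n))) \<longlonglongrightarrow> R x" by (simp add: divide_inverse)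
  qed simp
  also have "\<dots> \<le> liminf (\<lambda>n. \<integral>\<^sup>+x. ennreal (R x / (1 + R x / real (Suc n))) \<partial>\<mu>)"
    by (rule nn_integral_liminf) measurable
  also have "\<dots> \<le> 1"
    using bound by (intro Liminf_le) auto
  finally have "(\<integral>\<^sup>+x. ennreal (R x) \<partial>\<mu>) \<le> 1" .
  also have "(\<integral>\<^sup>+x. ennreal (R x) \<partial>\<mu>) = (\<integral>\<^sup>+x. ennreal (exp (- ln (mix d l x))) * ennreal (x j) \<partial>\<mu>)"
    by (intro nn_integral_cong) (simp add: R_def ennreal_mult'' mult.commute)
  finally show ?thesis .
qed

text \<open>
  A subprobability density is completed to a probability measure by putting the missing mass at one
  point \<open>e\<close>.  The mixture of the two parts is realised as an image of a weighted measure
  on \<open>bool \<times> space \<mu>\<close>, whose first component selects the part.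
\<close>

lemma complete_subprobability:
  fixes f :: "'a \<Rightarrow> ennreal"
  assumes \<mu>: "prob_space \<mu>" and [measurable]: "f \<in> borel_measurable \<mu>"
    and mass: "(\<integral>\<^sup>+x. f x \<partial>\<mu>) \<le> 1" and e [measurable]: "e \<in> space \<mu>"
  obtains \<nu> where "prob_space \<nu>" "sets \<nu> = sets \<mu>"
    "\<And>k. k \<in> borel_measurable \<mu> \<Longrightarrow>
      (\<integral>\<^sup>+x. k x \<partial>\<nu>) = (\<integral>\<^sup>+x. f x * k x \<partial>\<mu>) + (1 - (\<integral>\<^sup>+x. f x \<partial>\<mu>)) * k e"
proof -
  interpret prob_space \<mu> by fact
  define r where "r = 1 - (\<integral>\<^sup>+x. f x \<partial>\<mu>)"
  let ?B = "count_space (UNIV :: bool set)"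
  have \<mu>_sf: "sigma_finite_measure \<mu>" by unfold_locales
  define w where "w = (\<lambda>(b, x). if b then f x else r)"
  define \<phi> where "\<phi> = (\<lambda>(b, x). if b then x else e)"
  have [measurable]: "w \<in> borel_measurable (?B \<Otimes>\<^sub>M \<mu>)" unfolding w_def by measurable
  have [measurable]: "\<phi> \<in> measurable (?B \<Otimes>\<^sub>M \<mu>) \<mu>" unfolding \<phi>_def by measurable
  define \<nu> where "\<nu> = distr (density (?B \<Otimes>\<^sub>M \<mu>) w) \<mu> \<phi>"
  have integral: "(\<integral>\<^sup>+x. k x \<partial>\<nu>) = (\<integral>\<^sup>+x. f x * k x \<partial>\<mu>) + r * k e"
    if [measurable]: "k \<in> borel_measurable \<mu>" for k
  proof -
    have "(\<integral>\<^sup>+x. k x \<partial>\<nu>) = (\<integral>\<^sup>+z. w z * k (\<phi> z) \<partial>(?B \<Otimes>\<^sub>M \<mu>))"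
      by (simp add: \<nu>_def nn_integral_distr nn_integral_density)
    also have "\<dots> = (\<integral>\<^sup>+b. \<integral>\<^sup>+x. w (b, x) * k (\<phi> (b, x)) \<partial>\<mu> \<partial>?B)"
      by (rule sigma_finite_measure.nn_integral_fst[OF \<mu>_sf, symmetric]) measurable
    also have "\<dots> = (\<integral>\<^sup>+x. f x * k x \<partial>\<mu>) + r * k e"
      by (simp add: nn_integral_count_space_finite UNIV_bool w_def \<phi>_def emeasure_space_1 add.commute)
    finally show ?thesis .
  qed
  have sets_\<nu>: "sets \<nu> = sets \<mu>" by (simp add: \<nu>_def)
  have "emeasure \<nu> (space \<nu>) = (\<integral>\<^sup>+x. 1 \<partial>\<nu>)" by simp
  also have "\<dots> = (\<integral>\<^sup>+x. f x \<partial>\<mu>) + r" by (subst integral) auto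
  also have "\<dots> = 1" unfolding r_def using mass by (rule add_diff_inverse_ennreal)
  finally have "prob_space \<nu>" by (rule prob_spaceI)
  then show ?thesis using sets_\<nu> integral unfolding r_def by (rule that)
qed

section \<open>Independent and identically distributed paths\<close>

lemma path_space_eq: "path_space d = PiM {1..} (\<lambda>_. vec_space d)"
  by (simp add: path_space_def)

lemma measurable_evec: "n \<ge> 1 \<Longrightarrow> evec n \<in> measurable (path_space d) (vec_space d)"
  unfolding path_space_eq evec_def[abs_def] by (intro measurable_component_singleton) auto

text \<open>
  The canonical filtration is generated by coordinate events, which are preimages under restriction
  to the first \<open>n\<close> coordinates.
\<close>

lemma sets_filt_subset_past: "sets (filt d n) \<subseteq> past (vec_space d) n"
proof -
  let ?V = "vimage_algebra (space (path_space d)) (\<lambda>\<omega>. restrict \<omega> {1..n}) (PiM {1..n} (\<lambda>_. vec_space d))"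
  let ?G = "\<Union>i\<in>{1..n}. {evec i -` A \<inter> space (path_space d) | A. A \<in> sets (vec_space d)}"
  have "?G \<subseteq> sets ?V"
  proof safe
    fix i A assume i: "i \<in> {1..n}" and [measurable]: "A \<in> sets (vec_space d)"
    let ?B = "(\<lambda>x. x i) -` A \<inter> space (PiM {1..n} (\<lambda>_. vec_space d))"
    have "?B \<in> sets (PiM {1..n} (\<lambda>_. vec_space d))"
      using i by (intro measurable_sets[of _ _ "vec_space d"] measurable_component_singleton) auto
    then have "(\<lambda>\<omega>. restrict \<omega> {1..n}) -` ?B \<inter> space (path_space d) \<in> sets ?V"
      by (rule in_vimage_algebra)
    also have "(\<lambda>\<omega>. restrict \<omega> {1..n}) -` ?B \<inter> space (path_space d) = evec i -` A \<inter> space (path_space d)"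
      using i by (auto simp: evec_def path_space_eq space_PiM PiE_iff)
    finally show "evec i -` A \<inter> space (path_space d) \<in> sets ?V" .
  qed
  then have "sigma_sets (space (path_space d)) ?G \<subseteq> sets ?V"
    using sets.sigma_sets_subset[of ?G ?V] by simp
  moreover have "sets (filt d n) = sigma_sets (space (path_space d)) ?G"
    unfolding filt_def by (rule sets_measure_of) auto
  ultimately show ?thesis unfolding path_space_eq sets_past by simp
qed

lemma is_stopping_time_imp_adapted:
  assumes "is_stopping_time d \<tau>" "sets M = sets (vec_space d)"
  shows "adapted_stopping M \<tau>"
proof -
  have "sets (PiM {1::nat..} (\<lambda>_. M)) = sets (path_space d)"
    unfolding path_space_eq by (intro sets_PiM_cong refl assms)
  then have "space (PiM {1::nat..} (\<lambda>_. M)) = space (path_space d)"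
    by (rule sets_eq_imp_space_eq)
  then show ?thesis
    using assms(1) sets_filt_subset_past[of d]
    unfolding adapted_stopping_def is_stopping_time_def past_cong[OF assms(2)] by auto
qed

text \<open>
  A path is the family of its coordinates, so the joint law of all coordinates is the distribution
  itself.  Being i.i.d. therefore means being an infinite product measure with equal factors.
\<close>

lemma distr_all_coordinates:
  assumes sets_P: "sets P = sets (path_space d)"
  shows "distr P (PiM {1..} (\<lambda>_. vec_space d)) (\<lambda>\<omega>. \<lambda>i\<in>{1..}. evec i \<omega>) = P"
proof -
  have "distr P (PiM {1..} (\<lambda>_. vec_space d)) (\<lambda>\<omega>. \<lambda>i\<in>{1..}. evec i \<omega>) = distr P P (\<lambda>\<omega>. \<omega>)"
  proof (rule distr_cong)
    show "sets (PiM {1..} (\<lambda>_. vec_space d)) = sets P" using sets_P by (simp add: path_space_eq)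
    fix \<omega> assume "\<omega> \<in> space P"
    then show "(\<lambda>i\<in>{1..}. evec i \<omega>) = \<omega>"
      unfolding sets_eq_imp_space_eq[OF sets_P] path_space_eq by (auto simp: evec_def[abs_def] space_PiM)
  qed simp
  then show ?thesis by simp
qed

lemma iid_distributions_eq_PiM:
  assumes Q: "Q \<in> iid_distributions d"
  shows "Q = PiM {1..} (\<lambda>_. distr Q (vec_space d) (evec 1))"
proof -
  interpret prob_space Q using Q unfolding iid_distributions_def by blast
  have sets_Q: "sets Q = sets (path_space d)" using Q unfolding iid_distributions_def by blast
  have meas: "evec i \<in> measurable Q (vec_space d)" if "i \<in> {1..}" for i
    using measurable_evec[of i d] that by (simp add: measurable_cong_sets[OF sets_Q refl])
  have indep: "indep_vars (\<lambda>_. vec_space d) evec {1..}"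
    and marginals: "\<And>n. n \<ge> 1 \<Longrightarrow> distr Q (vec_space d) (evec n) = distr Q (vec_space d) (evec 1)"
    using Q unfolding iid_distributions_def by blast+
  have "distr Q (PiM {1..} (\<lambda>_. vec_space d)) (\<lambda>\<omega>. \<lambda>i\<in>{1..}. evec i \<omega>)
      = PiM {1..} (\<lambda>i. distr Q (vec_space d) (evec i))"
    by (rule indep_vars_iff_distr_eq_PiM'[THEN iffD1, OF _ meas indep]) simp
  also have "\<dots> = PiM {1..} (\<lambda>_. distr Q (vec_space d) (evec 1))"
    by (intro PiM_cong refl) (rule marginals, simp)
  finally show ?thesis unfolding distr_all_coordinates[OF sets_Q] .
qed

lemma PiM_in_iid_distributions:
  assumes \<nu>: "prob_space \<nu>" and sets_\<nu>: "sets \<nu> = sets (vec_space d)"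
  shows "PiM {1..} (\<lambda>_. \<nu>) \<in> iid_distributions d"
proof -
  let ?P = "PiM {1::nat..} (\<lambda>_. \<nu>)"
  interpret P: prob_space ?P by (intro prob_space_PiM \<nu>)
  have sets_P: "sets ?P = sets (path_space d)"
    unfolding path_space_eq by (intro sets_PiM_cong refl sets_\<nu>)
  have meas: "evec i \<in> measurable ?P (vec_space d)" if "i \<in> {1..}" for i
    using measurable_evec[of i d] that by (simp add: measurable_cong_sets[OF sets_P refl])
  have marginal: "distr ?P (vec_space d) (evec i) = \<nu>" if "i \<ge> 1" for i
  proof -
    have "distr ?P (vec_space d) (evec i) = distr ?P \<nu> (\<lambda>\<omega>. \<omega> i)"
      by (intro distr_cong) (auto simp: sets_\<nu> evec_def)
    also have "\<dots> = \<nu>"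
      using that by (intro distr_PiM_component[where M="\<lambda>_. \<nu>"] \<nu>) auto
    finally show ?thesis .
  qed
  have product: "PiM {1..} (\<lambda>i. distr ?P (vec_space d) (evec i)) = ?P"
    by (intro PiM_cong refl) (simp add: marginal)
  have "P.indep_vars (\<lambda>_. vec_space d) evec {1..}"
    by (intro P.indep_vars_iff_distr_eq_PiM'[THEN iffD2] meas
          trans[OF distr_all_coordinates[OF sets_P] product[symmetric]]) simp_all
  then show ?thesis
    using P.prob_space_axioms sets_P by (simp add: iid_distributions_def marginal)
qed

theorem proposition3p2:
  fixes d :: nat and \<alpha> :: real and \<tau> :: "path \<Rightarrow> enat" and Q :: "path measure"
  assumes "0 < \<alpha>" and "\<alpha> < 1"
    and "is_stopping_time d \<tau>"
    and "(SUP P\<in>null_distributions d. emeasure P {\<omega> \<in> space P. \<tau> \<omega> < \<infinity>}) \<le> ennreal \<alpha>"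
    and "Q \<in> iid_distributions d"
    and "\<And>l. l \<in> prob_simplex d \<Longrightarrow> expectation_defined Q (log_mix d l)"
    and "ell_star d Q > 0"
  shows "(\<exists>l\<in>prob_simplex d. ext_expectation Q (log_mix d l) = ell_star d Q) \<and>
    enn2ereal (\<integral>\<^sup>+ \<omega>. ennreal_of_enat (\<tau> \<omega>) \<partial>Q) / ereal (ln (1 / \<alpha>)) \<ge> 1 / ell_star d Q"
proof -
  interpret Q: prob_space Q using assms(5) unfolding iid_distributions_def by blast
  have sets_Q: "sets Q = sets (path_space d)" using assms(5) unfolding iid_distributions_def by blast
  define \<mu> where "\<mu> = distr Q (vec_space d) (evec 1)"
  have evec1 [measurable]: "evec 1 \<in> measurable Q (vec_space d)"
    using measurable_evec[of 1 d] by (simp add: measurable_cong_sets[OF sets_Q refl])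
  have \<mu>: "prob_space \<mu>" unfolding \<mu>_def by (rule Q.prob_space_distr) (rule evec1)
  have sets_\<mu> [measurable_cong]: "sets \<mu> = sets (vec_space d)" by (simp add: \<mu>_def)
  have space_\<mu>: "space \<mu> = space (vec_space d)" by (rule sets_eq_imp_space_eq[OF sets_\<mu>])
  have Q_eq: "Q = PiM {1..} (\<lambda>_. \<mu>)"
    unfolding \<mu>_def by (rule iid_distributions_eq_PiM[OF assms(5)])
  have ext: "ext_expectation Q (log_mix d l) = ext_expectation \<mu> (\<lambda>x. elog (mix d l x))" for l
    unfolding ext_expectation_def \<mu>_def log_mix_def mix_def[symmetric]
    by (simp add: nn_integral_distr)
  obtain l where l: "l \<in> prob_simplex d" and optimal: "\<And>l'. l' \<in> prob_simplex d \<Longrightarrow>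
      ext_expectation \<mu> (\<lambda>x. elog (mix d l' x)) \<le> ext_expectation \<mu> (\<lambda>x. elog (mix d l x))"
    using log_optimal_mixture_exists[OF \<mu> sets_\<mu>] by blast
  have attained: "ext_expectation Q (log_mix d l) = ell_star d Q"
    unfolding ell_star_def ext using l optimal by (intro antisym SUP_upper SUP_least)
  let ?T = "\<integral>\<^sup>+ \<omega>. ennreal_of_enat (\<tau> \<omega>) \<partial>Q"
  have log_pos: "0 < ln (1 / \<alpha>)" using assms(1,2) by simp
  have "1 / ell_star d Q \<le> enn2ereal ?T / ereal (ln (1 / \<alpha>))"
  (* When one of the two quantities is infinite, the bound is an instance of 1 / \<infinity> = 0 or of
     \<infinity> / r = \<infinity>. *)
  proof (cases "?T = \<infinity> \<or> ell_star d Q = \<infinity>")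
    case True
    then show ?thesis
    proof
      assume "?T = \<infinity>"
      then show ?thesis using log_pos by simp
    next
      assume "ell_star d Q = \<infinity>"
      then show ?thesis using log_pos by (simp add: zero_le_divide_ereal)
    qed
  next
    case False
    then obtain T where T: "?T = ennreal T" "0 \<le> T" by (cases ?T) auto
    from False assms(7) obtain \<kappa> where \<kappa>: "ell_star d Q = ereal \<kappa>" "0 < \<kappa>"
      by (cases "ell_star d Q") auto
    let ?P = "\<integral>\<^sup>+x. e2ennreal (elog (mix d l x)) \<partial>\<mu>" and ?N = "\<integral>\<^sup>+x. e2ennreal (- elog (mix d l x)) \<partial>\<mu>"
    have PN: "enn2ereal ?P - enn2ereal ?N = ereal \<kappa>"
      using attained \<kappa> ext[of l] by (simp add: ext_expectation_def)
    then obtain p where p: "?P = ennreal p" "0 \<le> p" by (cases ?P; cases ?N) auto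
    with PN obtain q where q: "?N = ennreal q" "0 \<le> q" by (cases ?N) auto
    have \<kappa>_eq: "\<kappa> = p - q" using PN p q by (simp add: enn2ereal_ennreal)
    define f where "f x = ennreal (exp (- ln (mix d l x)))" for x
    have f [measurable]: "f \<in> borel_measurable \<mu>" unfolding f_def by measurable
    have numeraire: "(\<integral>\<^sup>+x. f x * ennreal (x j) \<partial>\<mu>) \<le> 1" if "j \<in> {0..d}" for j
      unfolding f_def by (rule log_optimal_numeraire[OF \<mu> sets_\<mu> l optimal p q that])
    (* The case j = 0 of the first-order condition, as the coordinate 0 is constantly 1. *)
    have mass: "(\<integral>\<^sup>+x. f x \<partial>\<mu>) \<le> 1"
    proof -
      have "(\<integral>\<^sup>+x. f x \<partial>\<mu>) = (\<integral>\<^sup>+x. f x * ennreal (x 0) \<partial>\<mu>)"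
        by (intro nn_integral_cong) (auto simp: space_\<mu> space_vec_space)
      then show ?thesis using numeraire[of 0] by simp
    qed
    (* The vector e = (1, 0, ..., 0) carries the missing mass: it adds nothing to the expectations of
       the coordinates 1, ..., d, so they remain at most 1. *)
    define e where "e = (\<lambda>j\<in>{0..d}. if j = 0 then 1 else 0 :: real)"
    have e: "e \<in> space \<mu>" by (auto simp: e_def space_\<mu> space_vec_space)
    obtain \<nu> where \<nu>: "prob_space \<nu>" and sets_\<nu>\<mu>: "sets \<nu> = sets \<mu>"
      and integral_\<nu>: "\<And>k. k \<in> borel_measurable \<mu> \<Longrightarrow>
        (\<integral>\<^sup>+x. k x \<partial>\<nu>) = (\<integral>\<^sup>+x. f x * k x \<partial>\<mu>) + (1 - (\<integral>\<^sup>+x. f x \<partial>\<mu>)) * k e"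
      using complete_subprobability[OF \<mu> f mass e] by blast
    let ?P = "PiM {1::nat..} (\<lambda>_. \<nu>)"
    have "(\<integral>\<^sup>+\<omega>. ennreal (evec 1 \<omega> j) \<partial>?P) \<le> 1" if j: "j \<in> {1..d}" for j
    proof -
      have [measurable]: "(\<lambda>x. x j) \<in> borel_measurable (vec_space d)"
        using j by (intro measurable_coordinate) auto
      have "(\<integral>\<^sup>+\<omega>. ennreal (evec 1 \<omega> j) \<partial>?P) = (\<integral>\<^sup>+x. ennreal (x j) \<partial>distr ?P \<nu> (\<lambda>\<omega>. \<omega> 1))"
      proof -
        have "(\<lambda>x. ennreal (x j)) \<in> borel_measurable \<nu>"
          unfolding measurable_cong_sets[OF trans[OF sets_\<nu>\<mu> sets_\<mu>] refl] by measurable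
        then show ?thesis by (subst nn_integral_distr) (auto simp: evec_def)
      qed
      also have "\<dots> = (\<integral>\<^sup>+x. ennreal (x j) \<partial>\<nu>)"
        by (subst distr_PiM_component) (auto intro: \<nu>)
      also have "\<dots> = (\<integral>\<^sup>+x. f x * ennreal (x j) \<partial>\<mu>)"
        using j by (subst integral_\<nu>) (auto simp: e_def)
      also have "\<dots> \<le> 1" using j by (intro numeraire) auto
      finally show ?thesis .
    qed
    then have "?P \<in> null_distributions d"
      using PiM_in_iid_distributions[OF \<nu> trans[OF sets_\<nu>\<mu> sets_\<mu>]] by (simp add: null_distributions_def)
    then have stop: "emeasure ?P {\<omega> \<in> space ?P. \<tau> \<omega> < \<infinity>} \<le> ennreal \<alpha>"
      using assms(4) by (meson SUP_upper order_trans)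
    have X: "(\<lambda>x. ln (mix d l x)) \<in> borel_measurable \<mu>" by measurable
    have AE_pos: "AE x in \<mu>. x \<in> space (vec_space d) \<and> 0 < mix d l x"
      using q by (intro AE_mix_pos[OF sets_\<mu> l]) simp
    have p': "(\<integral>\<^sup>+x. ennreal (ln (mix d l x)) \<partial>\<mu>) = ennreal p"
      unfolding p(1)[symmetric]
      by (intro nn_integral_cong_AE, use AE_pos in eventually_elim) (auto simp: elog_def)
    have q': "(\<integral>\<^sup>+x. ennreal (- ln (mix d l x)) \<partial>\<mu>) = ennreal q"
      unfolding q(1)[symmetric]
      by (intro nn_integral_cong_AE, use AE_pos in eventually_elim) (auto simp: elog_def)
    have "exp (- ((p - q) * T)) \<le> \<alpha>"
    proof (rule expected_stopping_time_change_of_measure[OF \<mu> \<nu> sets_\<nu>\<mu> X _ p' q' q(2) _ _ stop])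
      show "(\<integral>\<^sup>+x. ennreal (exp (- ln (mix d l x))) * k x \<partial>\<mu>) \<le> (\<integral>\<^sup>+x. k x \<partial>\<nu>)"
        if "k \<in> borel_measurable \<mu>" for k
        using integral_\<nu>[OF that] by (simp add: f_def)
      show "adapted_stopping \<mu> \<tau>" by (rule is_stopping_time_imp_adapted[OF assms(3) sets_\<mu>])
      show "(\<integral>\<^sup>+\<omega>. ennreal_of_enat (\<tau> \<omega>) \<partial>PiM {1..} (\<lambda>_. \<mu>)) = ennreal T"
        using T(1) unfolding Q_eq[symmetric] .
    qed (use T \<kappa> \<kappa>_eq assms(1) in auto)
    then have "- (\<kappa> * T) \<le> ln \<alpha>"
      using assms(1) unfolding \<kappa>_eq by (subst (asm) ln_ge_iff[symmetric]) auto
    then have "ln (1 / \<alpha>) \<le> \<kappa> * T" using assms(1) by (simp add: ln_div)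
    then have "1 / \<kappa> \<le> T / ln (1 / \<alpha>)" using \<kappa>(2) log_pos by (simp add: field_simps)
    then show ?thesis using T \<kappa> log_pos by (simp add: enn2ereal_ennreal one_ereal_def)
  qed
  then show ?thesis using l attained by blast
qed

end
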